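(* For any preorder $\leq$ on $\mathrm{Mon}_n$, the inequality $x^\alpha \leq x^\beta$ (as a condition on $\alpha,\beta \in \mathbb{Z}_{\geq 0}^n$) is equivalent to a finite boolean combination of inequalities of the following three forms: \[ \alpha_i \leq a; \quad \beta_i \leq a; \quad \text{and} \quad \langle \alpha,\mu\rangle \leq \langle \beta,\mu\rangle + c, \] where $i \in [n]:=\{1,\ldots,n\}$, $a \in \mathbb{Z}_{\geq 0}$, $\mu \in \mathbb{R}^n$, and $c \in \mathbb{R}$.
   Context: $\mathrm{Mon}_n=\{x^\alpha \mid \alpha \in \mathbb{Z}_{\geq 0}^n\}$ is the commutative monoid of monomials in $n$ variables under multiplication. A preorder on a commutative monoid $\Pi$ is a binary relation $\leq$ on $\Pi$ that is reflexive, transitive, and total, and satisfies $v \leq w \Rightarrow uv \leq uw$ for all $u,v,w \in \Pi$. $\langle\cdot,\cdot\rangle$ is the standard inner product on $\mathbb{R}^n$. *)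

theory Defs
  imports Complex_Main "HOL-Algebra.Group" "HOL-Library.Poly_Mapping"
begin

locale comm_monoid_preorder = Group.comm_monoid M for M (structure) +
  fixes le :: "'a \<Rightarrow> 'a \<Rightarrow> bool"
  assumes refl: "reflp_on (carrier M) le"
    and trans: "transp_on (carrier M) le"
    and total: "totalp_on (carrier M) le"
    and mult_mono: "\<And>u v w. \<lbrakk>u \<in> carrier M; v \<in> carrier M; w \<in> carrier M; le v w\<rbrakk>
      \<Longrightarrow> le (u \<otimes> v) (u \<otimes> w)"

text \<open>
  The monomial \<open>x\<^sup>\<alpha>\<close> in the variables \<open>x\<^sub>1, \<dots>, x\<^sub>n\<close> is represented by its exponent vector \<open>\<alpha>\<close>,
  so multiplication of monomials is addition of exponents.
\<close>
definition Mon :: "nat \<Rightarrow> (nat \<Rightarrow>\<^sub>0 nat) monoid" where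
  "Mon n = \<lparr>carrier = {\<alpha>. Poly_Mapping.keys \<alpha> \<subseteq> {1..n}}, mult = (+), one = 0\<rparr>"

lemma comm_monoid_Mon: "Group.comm_monoid (Mon n)"
  by (rule comm_monoidI)
    (use Poly_Mapping.keys_add in \<open>fastforce simp: Mon_def ac_simps\<close>)+

text \<open>
  The inner product of \<open>\<alpha>\<close> and \<open>\<mu>\<close> in \<open>\<real>\<^sup>n\<close>; a vector of \<open>\<real>\<^sup>n\<close> is given by the values of
  \<open>\<mu>\<close> at \<open>1, \<dots>, n\<close>, its other values being irrelevant.
\<close>
definition inner_upto :: "nat \<Rightarrow> (nat \<Rightarrow>\<^sub>0 nat) \<Rightarrow> (nat \<Rightarrow> real) \<Rightarrow> real" where
  "inner_upto n \<alpha> \<mu> = (\<Sum>i = 1..n. real (Poly_Mapping.lookup \<alpha> i) * \<mu> i)"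

inductive_set basic_inequalities :: "nat \<Rightarrow> ((nat \<Rightarrow>\<^sub>0 nat) \<Rightarrow> (nat \<Rightarrow>\<^sub>0 nat) \<Rightarrow> bool) set"
  for n :: nat where
  left: "i \<in> {1..n} \<Longrightarrow> (\<lambda>\<alpha> \<beta>. Poly_Mapping.lookup \<alpha> i \<le> a) \<in> basic_inequalities n"
| right: "i \<in> {1..n} \<Longrightarrow> (\<lambda>\<alpha> \<beta>. Poly_Mapping.lookup \<beta> i \<le> a) \<in> basic_inequalities n"
| linear: "(\<lambda>\<alpha> \<beta>. inner_upto n \<alpha> \<mu> \<le> inner_upto n \<beta> \<mu> + c) \<in> basic_inequalities n"

inductive_set boolean_combinations :: "('a \<Rightarrow> 'b \<Rightarrow> bool) set \<Rightarrow> ('a \<Rightarrow> 'b \<Rightarrow> bool) set"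
  for B :: "('a \<Rightarrow> 'b \<Rightarrow> bool) set" where
  basic: "P \<in> B \<Longrightarrow> P \<in> boolean_combinations B"
| true: "(\<lambda>x y. True) \<in> boolean_combinations B"
| neg: "P \<in> boolean_combinations B \<Longrightarrow> (\<lambda>x y. \<not> P x y) \<in> boolean_combinations B"
| conj: "P \<in> boolean_combinations B \<Longrightarrow> Q \<in> boolean_combinations B
    \<Longrightarrow> (\<lambda>x y. P x y \<and> Q x y) \<in> boolean_combinations B"
| disj: "P \<in> boolean_combinations B \<Longrightarrow> Q \<in> boolean_combinations B
    \<Longrightarrow> (\<lambda>x y. P x y \<or> Q x y) \<in> boolean_combinations B"

end

theory Submission
  imports Defs
begin

text \<open>
  On a box \<open>u + \<nat>\<^sup>I\<close>, \<open>v + \<nat>\<^sup>J\<close> with \<open>K = I \<union> J\<close>, compare \<open>\<le>\<close> with the preorder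
  \<open>\<le>\<^sub>K\<close> in which the variables of \<open>K\<close> have been made cancellable. For exponents in
  \<open>\<nat>\<^sup>K\<close>, whether \<open>u + \<alpha> \<le>\<^sub>K v + \<beta>\<close> depends only on \<open>\<alpha> - \<beta>\<close> and describes a
  down-closed subset of the totally preordered group \<open>\<int>\<^sup>K\<close>. Such a subset is cut out by
  finitely many linear inequalities: Hoelder's theorem gives a nonzero monotone real functional
  \<open>\<phi>\<close>, the subset is decided by \<open>\<phi>\<close> away from one level \<open>\<phi> = c\<close>, and on that level one
  recurses into the kernel of \<open>\<phi>\<close>, which has smaller rank.

  By Dickson's lemma a single \<open>\<gamma> \<in> \<nat>\<^sup>K\<close> turns every \<open>\<le>\<^sub>K\<close>-equivalence between
  \<open>u + \<nat>\<^sup>K\<close> and \<open>v + \<nat>\<^sup>K\<close> into an equivalence for \<open>\<le>\<close> after adding \<open>\<gamma>\<close>. It follows that, for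
  all sufficiently large exponents in the box, \<open>\<le>\<close> is either \<open>\<le>\<^sub>K\<close> or its strict part. The
  remaining exponents lie in finitely many slices of smaller dimension.
\<close>

abbreviation lookup :: "('a \<Rightarrow>\<^sub>0 'b::zero) \<Rightarrow> 'a \<Rightarrow> 'b" where
  "lookup \<equiv> Poly_Mapping.lookup"

section \<open>Dickson's lemma\<close>

text \<open>Induction on the coordinates: if \<open>F\<close> works for \<open>S\<close> and
  \<open>m\<close> bounds the \<open>i\<close>-th coordinate on \<open>F\<close>, then points with
  \<open>i\<close>-th coordinate above \<open>m\<close> lie above an element of \<open>F\<close>,
  and the others fall into finitely many slices where that coordinate is constant. Using a map
  \<open>f\<close> on arbitrary points lets the result apply to pairs of exponents.\<close>

lemma dickson:
  fixes f :: "'a \<Rightarrow> 'i \<Rightarrow> nat"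
  assumes "finite S"
  shows "\<exists>F. finite F \<and> F \<subseteq> A \<and> (\<forall>a\<in>A. \<exists>b\<in>F. \<forall>i\<in>S. f b i \<le> f a i)"
  using assms
proof (induction S arbitrary: A rule: finite_induct)
  case empty
  show ?case
  proof (cases "A = {}")
    case False
    then obtain a where "a \<in> A" by blast
    then show ?thesis by (intro exI[of _ "{a}"]) auto
  qed simp
next
  case (insert i S)
  obtain F where F: "finite F" "F \<subseteq> A" "\<forall>a\<in>A. \<exists>b\<in>F. \<forall>i\<in>S. f b i \<le> f a i"
    using insert.IH[of A] by blast
  obtain m where m: "\<forall>b\<in>F. f b i \<le> m"
    using F(1) finite_nat_set_iff_bounded_le[of "(\<lambda>b. f b i) ` F"] by auto
  have "\<forall>c. \<exists>F'. finite F' \<and> F' \<subseteq> {a\<in>A. f a i = c} \<and>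
    (\<forall>a\<in>{a\<in>A. f a i = c}. \<exists>b\<in>F'. \<forall>i\<in>S. f b i \<le> f a i)"
    by (intro allI insert.IH)
  from choice[OF this] obtain F' where F': "\<forall>c. finite (F' c) \<and> F' c \<subseteq> {a\<in>A. f a i = c} \<and>
    (\<forall>a\<in>{a\<in>A. f a i = c}. \<exists>b\<in>F' c. \<forall>i\<in>S. f b i \<le> f a i)" ..
  then have fin: "\<And>c. finite (F' c)" and sub: "\<And>c. F' c \<subseteq> {a\<in>A. f a i = c}"
    and dom: "\<And>a. a \<in> A \<Longrightarrow> \<exists>b\<in>F' (f a i). \<forall>i\<in>S. f b i \<le> f a i"
    by simp_all
  show ?case
  proof (intro exI conjI ballI)
    show "finite (F \<union> (\<Union>c\<le>m. F' c))" using F(1) fin by simp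
    show "F \<union> (\<Union>c\<le>m. F' c) \<subseteq> A" using F(2) sub by fast
    fix a assume a: "a \<in> A"
    show "\<exists>b\<in>F \<union> (\<Union>c\<le>m. F' c). \<forall>j\<in>insert i S. f b j \<le> f a j"
    proof (cases "f a i \<le> m")
      case True
      obtain b where "b \<in> F' (f a i)" "\<forall>j\<in>S. f b j \<le> f a j" using dom[OF a] by blast
      then show ?thesis using True sub[of "f a i"] by (intro bexI[of _ b]) auto
    next
      case False
      obtain b where "b \<in> F" "\<forall>j\<in>S. f b j \<le> f a j" using F(3) a by blast
      then show ?thesis using False m by (intro bexI[of _ b]) (auto intro: order_trans)
    qed
  qed
qed

section \<open>Subgroups of the integer lattice with a total preorder\<close>

text \<open>The ring structure serves to write integer multiples as \<open>of_int k * x\<close>;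
  \<open>G\<close> need not be a subring.\<close>

locale additive_subgroup =
  fixes G :: "'a::comm_ring_1 set"
  assumes zero: "0 \<in> G" and diff: "\<And>x y. x \<in> G \<Longrightarrow> y \<in> G \<Longrightarrow> x - y \<in> G"
begin

lemma uminus: "x \<in> G \<Longrightarrow> - x \<in> G"
  using diff[of 0 x] zero by simp

lemma add: "x \<in> G \<Longrightarrow> y \<in> G \<Longrightarrow> x + y \<in> G"
  using diff[of x "- y"] uminus by simp

lemma of_nat_mult: "x \<in> G \<Longrightarrow> of_nat m * x \<in> G"
  by (induction m) (auto simp: zero add distrib_right)

lemma of_int_mult: "x \<in> G \<Longrightarrow> of_int k * x \<in> G"
  by (cases k rule: int_cases) (auto simp: of_nat_mult uminus simp flip: of_nat_Suc)

end

text \<open>\<open>P\<close> is the cone of nonnegative elements, and \<open>P \<inter> - P\<close>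
  may be nontrivial. As \<open>P\<close> may reach outside \<open>G\<close>, the same
  \<open>P\<close> orders every kernel on which the inductions recurse.\<close>

locale preordered_subgroup = additive_subgroup G for G :: "'a::comm_ring_1 set" +
  fixes P :: "'a set"
  assumes P_zero: "0 \<in> P"
    and P_add: "\<And>x y. x \<in> P \<Longrightarrow> y \<in> P \<Longrightarrow> x + y \<in> P"
    and P_total: "\<And>x. x \<in> G \<Longrightarrow> x \<in> P \<or> - x \<in> P"
begin

lemma P_of_nat_mult: "x \<in> P \<Longrightarrow> of_nat m * x \<in> P"
  by (induction m) (auto simp: P_zero P_add distrib_right)

lemma P_of_int_mult: "x \<in> P \<Longrightarrow> k \<ge> 0 \<Longrightarrow> of_int k * x \<in> P"
  using P_of_nat_mult[of x "nat k"] by simp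

text \<open>For \<open>k < 0\<close>, adding \<open>- k - 1\<close> copies of \<open>g\<close> would
  leave \<open>- g\<close> in \<open>P\<close>.\<close>

lemma P_of_int_multD:
  assumes "of_int k * g \<in> P" "g \<in> P" "- g \<notin> P"
  shows "k \<ge> 0"
proof (rule ccontr)
  assume "\<not> k \<ge> 0"
  then have "of_int (- k - 1) * g \<in> P"
    using assms(2) by (intro P_of_int_mult) auto
  from P_add[OF assms(1) this] show False using assms(3) by (simp add: algebra_simps)
qed

text \<open>
  Hoelder's construction: \<open>\<phi> x\<close> is the supremum of the fractions \<open>p / q\<close> with \<open>p g \<le> q x\<close>.
\<close>
lemma holder_functional:
  assumes g: "g \<in> G" "g \<in> P" "- g \<notin> P"
    and dom: "\<And>x. x \<in> G \<Longrightarrow> \<exists>N::nat. of_nat N * g - x \<in> P"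
  shows "\<exists>\<phi>::'a \<Rightarrow> real. (\<forall>x\<in>G. \<forall>y\<in>G. \<phi> (x + y) = \<phi> x + \<phi> y) \<and> (\<forall>x\<in>G \<inter> P. \<phi> x \<ge> 0) \<and> \<phi> g > 0"
proof -
  define A :: "'a \<Rightarrow> real set" where
    "A x = {real_of_int p / real_of_int q |p q. q > 0 \<and> of_int q * x - of_int p * g \<in> P}" for x
  define \<phi> where "\<phi> x = Sup (A x)" for x
  have AI: "real_of_int p / real_of_int q \<in> A x" if "q > 0" "of_int q * x - of_int p * g \<in> P" for p q x
    using that by (auto simp: A_def)
  have ne: "A x \<noteq> {}" if x: "x \<in> G" for x
  proof -
    obtain N where "of_nat N * g - (- x) \<in> P" using dom[OF uminus[OF x]] by blast
    then have "of_int (-int N) / of_int 1 \<in> A x" by (intro AI) (auto simp: algebra_simps)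
    then show ?thesis by blast
  qed
  have bdd: "bdd_above (A x)" if x: "x \<in> G" for x
  proof -
    obtain N where N: "of_nat N * g - x \<in> P" using dom[OF x] by blast
    have "r \<le> real N" if "r \<in> A x" for r
    proof -
      obtain p q where r: "r = of_int p / of_int q" "q > 0" "of_int q * x - of_int p * g \<in> P"
        using \<open>r \<in> A x\<close> by (auto simp: A_def)
      have "(of_int q * x - of_int p * g) + of_int q * (of_nat N * g - x) \<in> P"
        using r P_of_int_mult[OF N, of q] by (intro P_add) auto
      then have "of_int (q * int N - p) * g \<in> P" by (simp add: algebra_simps)
      from P_of_int_multD[OF this g(2,3)] have "real_of_int p \<le> real_of_int (q * int N)"
        by (simp only: of_int_le_iff)
      then show ?thesis using r(1,2) by (simp add: divide_le_eq mult.commute)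
    qed
    then show ?thesis by (auto simp: bdd_above_def)
  qed
  have upper: "r \<le> \<phi> x" if "r \<in> A x" "x \<in> G" for r x
    unfolding \<phi>_def using that bdd by (intro cSup_upper) auto
  have least: "\<phi> x \<le> b" if "x \<in> G" "\<And>r. r \<in> A x \<Longrightarrow> r \<le> b" for x b
    unfolding \<phi>_def using that ne by (intro cSup_least) auto
  \<comment> \<open>Fractions for \<open>x\<close> and \<open>y\<close> add up over the common
    denominator \<open>q * q'\<close>; suprema are then taken in one argument at a time.\<close>
  have super: "\<phi> x + \<phi> y \<le> \<phi> (x + y)" if x: "x \<in> G" and y: "y \<in> G" for x y
  proof -
    have sum: "r + s \<in> A (x + y)" if rs: "r \<in> A x" "s \<in> A y" for r s
    proof -
      obtain p q where r: "r = of_int p / of_int q" "q > 0" "of_int q * x - of_int p * g \<in> P"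
        using rs(1) by (auto simp: A_def)
      obtain p' q' where s: "s = of_int p' / of_int q'" "q' > 0" "of_int q' * y - of_int p' * g \<in> P"
        using rs(2) by (auto simp: A_def)
      have "of_int q' * (of_int q * x - of_int p * g) + of_int q * (of_int q' * y - of_int p' * g) \<in> P"
        using r s by (intro P_add P_of_int_mult) auto
      then have "of_int (q * q') * (x + y) - of_int (p * q' + p' * q) * g \<in> P"
        by (simp add: algebra_simps)
      then have "of_int (p * q' + p' * q) / of_int (q * q') \<in> A (x + y)" using r s by (intro AI) auto
      then show ?thesis using r s by (simp add: add_frac_eq mult.commute)
    qed
    have "\<phi> x \<le> \<phi> (x + y) - s" if s: "s \<in> A y" for s
    proof (rule least[OF x])
      fix r assume "r \<in> A x"
      from upper[OF sum[OF this s] add[OF x y]] show "r \<le> \<phi> (x + y) - s" by linarith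
    qed
    then have "s \<le> \<phi> (x + y) - \<phi> x" if "s \<in> A y" for s
      using that by fastforce
    from least[OF y this] have "\<phi> y \<le> \<phi> (x + y) - \<phi> x" .
    then show ?thesis by simp
  qed
  \<comment> \<open>Totality enters here: a rational \<open>p / q\<close> strictly between
    \<open>\<phi> x\<close> and \<open>- \<phi> (- x)\<close> is too large for \<open>A x\<close>,
    so its negative lies in \<open>A (- x)\<close>.\<close>
  have neg: "- \<phi> x \<le> \<phi> (- x)" if x: "x \<in> G" for x
  proof (rule ccontr)
    assume "\<not> - \<phi> x \<le> \<phi> (- x)"
    then obtain r where r: "r \<in> \<rat>" "\<phi> x < r" "r < - \<phi> (- x)"
      using Rats_dense_in_real[of "\<phi> x" "- \<phi> (- x)"] by auto
    then obtain p q where pq: "r = of_int p / of_int q" "q > 0"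
      by (metis Rats_cases')
    have "of_int q * x - of_int p * g \<notin> P"
      using AI[OF pq(2)] upper[OF _ x] r(2) pq(1) by fastforce
    then have "- (of_int q * x - of_int p * g) \<in> P"
      using P_total x g(1) by (metis diff of_int_mult)
    then have "of_int (- p) / of_int q \<in> A (- x)" using pq by (intro AI) (auto simp: algebra_simps)
    from upper[OF this uminus[OF x]] show False using r(3) pq by simp
  qed
  \<comment> \<open>Superadditivity for \<open>x = (x + y) + (- y)\<close>, combined with
    \<open>neg\<close>.\<close>
  have "\<phi> (x + y) \<le> \<phi> x + \<phi> y" if "x \<in> G" "y \<in> G" for x y
    using super[of "x + y" "- y"] neg[of y] that by (simp add: add uminus)
  with super have "\<phi> (x + y) = \<phi> x + \<phi> y" if "x \<in> G" "y \<in> G" for x y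
    using that by (simp add: order_antisym)
  moreover have "\<phi> x \<ge> 0" if "x \<in> G" "x \<in> P" for x
    using upper[OF AI[of 1 x 0]] that by simp
  \<comment> \<open>The fraction \<open>1 / 1\<close> lies in \<open>A g\<close>.\<close>
  moreover have "\<phi> g > 0"
    using upper[OF AI[of 1 g 1]] g P_zero by simp
  ultimately show ?thesis by blast
qed

end

section \<open>Coordinates of integer vectors and linear functionals\<close>

lemma lookup_of_nat_mult:
  fixes x :: "nat \<Rightarrow>\<^sub>0 int"
  shows "lookup (of_nat m * x) i = int m * lookup x i"
  by (induction m) (auto simp: lookup_add distrib_right)

lemma lookup_of_int_mult:
  fixes x :: "nat \<Rightarrow>\<^sub>0 int"
  shows "lookup (of_int k * x) i = k * lookup x i"
  by (cases k rule: int_cases) (auto simp: lookup_of_nat_mult lookup_uminus simp del: of_nat_Suc)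

text \<open>The \<open>i\<close>-th coordinates of \<open>G\<close> form a subgroup of the integers;
  \<open>d\<close> realises its generator, the least positive coordinate, or is 0 if there is
  none.\<close>

lemma subgroup_coordinate_generator:
  fixes G :: "(nat \<Rightarrow>\<^sub>0 int) set"
  assumes "additive_subgroup G"
  obtains d where "d \<in> G" "\<And>x. x \<in> G \<Longrightarrow> \<exists>q. lookup x i = q * lookup d i"
proof -
  interpret additive_subgroup G by fact
  show ?thesis
  proof (cases "\<forall>x\<in>G. lookup x i = 0")
    case True
    then show ?thesis using that[of 0] zero by simp
  next
    case False
    then obtain x where "x \<in> G" "lookup x i \<noteq> 0" by blast
    then have "\<exists>x. x \<in> G \<and> lookup x i > 0"
      using uminus[of x] by (cases "lookup x i > 0") (auto intro: exI[of _ x] exI[of _ "- x"])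
    then obtain d where d: "d \<in> G" "lookup d i > 0"
      and min: "\<And>y. y \<in> G \<Longrightarrow> lookup y i > 0 \<Longrightarrow> nat (lookup d i) \<le> nat (lookup y i)"
      using ex_has_least_nat[of "\<lambda>x. x \<in> G \<and> lookup x i > 0" _ "\<lambda>x. nat (lookup x i)"] by blast
    \<comment> \<open>Division with remainder: the remainder is again a coordinate of an element of
      \<open>G\<close>, so minimality forces it to be 0.\<close>
    have "lookup x i = (lookup x i div lookup d i) * lookup d i" if x: "x \<in> G" for x
    proof -
      have "x - of_int (lookup x i div lookup d i) * d \<in> G" using x d by (intro diff of_int_mult)
      from min[OF this] have "\<not> lookup x i mod lookup d i > 0"
        using d(2) pos_mod_bound[OF d(2), of "lookup x i"]
        by (auto simp: nat_le_eq_zle lookup_minus lookup_of_int_mult minus_div_mult_eq_mod)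
      then have "lookup x i mod lookup d i = 0"
        using pos_mod_sign[OF d(2), of "lookup x i"] by linarith
      then show ?thesis by (simp add: div_mult_mod_eq mod_0_imp_dvd)
    qed
    then show ?thesis using that d(1) by blast
  qed
qed

lemma additive_subgroup_coordinate_kernel:
  fixes G :: "(nat \<Rightarrow>\<^sub>0 int) set"
  assumes "additive_subgroup G"
  shows "additive_subgroup {x \<in> G. lookup x i = 0}"
  using assms by (auto simp: additive_subgroup_def lookup_minus)

text \<open>Coordinates are eliminated one at a time: the induction hypothesis gives the
  coefficients on the kernel of coordinate \<open>i\<close>, and the value at a generator
  \<open>d\<close> of that coordinate fixes the coefficient of \<open>i\<close>.\<close>

lemma additive_functional_representation:
  fixes G :: "(nat \<Rightarrow>\<^sub>0 int) set" and \<phi> :: "(nat \<Rightarrow>\<^sub>0 int) \<Rightarrow> real"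
  assumes "finite S" "additive_subgroup G"
    and "\<And>x y. x \<in> G \<Longrightarrow> y \<in> G \<Longrightarrow> \<phi> (x + y) = \<phi> x + \<phi> y"
    and "\<And>x. x \<in> G \<Longrightarrow> (\<And>i. i \<in> S \<Longrightarrow> lookup x i = 0) \<Longrightarrow> \<phi> x = 0"
  shows "\<exists>\<mu>. \<forall>x\<in>G. \<phi> x = (\<Sum>i\<in>S. real_of_int (lookup x i) * \<mu> i)"
  using assms
proof (induction S arbitrary: G rule: finite_induct)
  case empty
  then show ?case by simp
next
  case (insert i S)
  interpret additive_subgroup G by fact
  have "\<exists>\<mu>. \<forall>x\<in>{x \<in> G. lookup x i = 0}. \<phi> x = (\<Sum>i\<in>S. real_of_int (lookup x i) * \<mu> i)"
    using insert.prems by (intro insert.IH additive_subgroup_coordinate_kernel) auto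
  then obtain \<mu> where \<mu>: "\<And>x. x \<in> G \<Longrightarrow> lookup x i = 0 \<Longrightarrow> \<phi> x = (\<Sum>i\<in>S. real_of_int (lookup x i) * \<mu> i)"
    by blast
  obtain d where d: "d \<in> G" "\<And>x. x \<in> G \<Longrightarrow> \<exists>q. lookup x i = q * lookup d i"
    using subgroup_coordinate_generator insert.prems(1) by blast
  \<comment> \<open>Chosen so that the formula holds at \<open>d\<close>. If
    \<open>lookup d i = 0\<close>, division by zero gives \<open>c = 0\<close>, which is harmless
    because coordinate \<open>i\<close> then vanishes on \<open>G\<close>.\<close>
  define c where "c = (\<phi> d - (\<Sum>i\<in>S. real_of_int (lookup d i) * \<mu> i)) / lookup d i"
  have nat_mult: "\<phi> (of_nat m * x) = real m * \<phi> x" if "x \<in> G" for m x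
  proof (induction m)
    case 0
    show ?case using insert.prems(2)[OF zero zero] by simp
  next
    case (Suc m)
    then show ?case using insert.prems(2)[OF that of_nat_mult[OF that, of m]] by (simp add: algebra_simps)
  qed
  have minus: "\<phi> (- x) = - \<phi> x" if "x \<in> G" for x
    using insert.prems(2)[OF that uminus[OF that]] insert.prems(2)[OF zero zero] by simp
  have int_mult: "\<phi> (of_int k * x) = of_int k * \<phi> x" if "x \<in> G" for k x
    using nat_mult[OF that] minus[OF of_nat_mult[OF that]]
    by (cases k rule: int_cases) (auto simp del: of_nat_Suc)
  have "\<phi> x = (\<Sum>j\<in>insert i S. real_of_int (lookup x j) * (\<mu>(i := c)) j)" if x: "x \<in> G" for x
  proof -
    \<comment> \<open>For \<open>lookup d i = 0\<close> every \<open>q\<close> satisfies the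
      equation; taking 0 removes the multiple of \<open>\<phi> d\<close>.\<close>
    obtain q where q: "lookup x i = q * lookup d i" "lookup d i = 0 \<Longrightarrow> q = 0"
      using d(2)[OF x] by (metis mult_zero_right)
    define y where "y = x - of_int q * d"
    have y: "y \<in> G" unfolding y_def using x d by (intro diff of_int_mult)
    have y0: "lookup y i = 0" using q by (simp add: y_def lookup_minus lookup_of_int_mult)
    have "\<phi> x = \<phi> y + q * \<phi> d"
      using insert.prems(2)[OF y of_int_mult[OF d(1), of q]] int_mult[OF d(1)] by (simp add: y_def)
    also have "\<phi> y = (\<Sum>j\<in>S. real_of_int (lookup x j) * \<mu> j) - q * (\<Sum>j\<in>S. real_of_int (lookup d j) * \<mu> j)"
      unfolding \<mu>[OF y y0]
      by (simp add: y_def lookup_minus lookup_of_int_mult left_diff_distrib sum_subtractf sum_distrib_left mult.assoc)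
    also have "\<dots> + q * \<phi> d = (\<Sum>j\<in>S. real_of_int (lookup x j) * \<mu> j) + lookup x i * c"
      using q by (cases "lookup d i = 0") (simp_all add: c_def flip: right_diff_distrib)
    also have "(\<Sum>j\<in>S. real_of_int (lookup x j) * \<mu> j) = (\<Sum>j\<in>S. real_of_int (lookup x j) * (\<mu>(i := c)) j)"
      using insert.hyps by (intro sum.cong) auto
    finally show ?thesis using insert.hyps by simp
  qed
  then show ?case by blast
qed

text \<open>Supplies the order unit needed for Hoelder's construction. An order unit
  \<open>g\<close> for the kernel of coordinate \<open>i\<close> is enlarged by \<open>h\<close>, a
  nonnegative choice among \<open>d\<close> and \<open>- d\<close>, whose multiples control that
  coordinate.\<close>

lemma preordered_subgroup_dominant_element:
  fixes G :: "(nat \<Rightarrow>\<^sub>0 int) set"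
  assumes "finite S" "preordered_subgroup G P"
    and "\<And>x. x \<in> G \<Longrightarrow> (\<And>i. i \<in> S \<Longrightarrow> lookup x i = 0) \<Longrightarrow> x \<in> P"
  shows "\<exists>g\<in>G \<inter> P. \<forall>x\<in>G. \<exists>N::nat. of_nat N * g - x \<in> P"
  using assms
proof (induction S arbitrary: G rule: finite_induct)
  case empty
  interpret preordered_subgroup G P by fact
  show ?case using empty.prems(2) zero P_zero uminus by (intro bexI[of _ 0]) auto
next
  case (insert i S)
  interpret preordered_subgroup G P by fact
  have "preordered_subgroup {x \<in> G. lookup x i = 0} P"
    using insert.prems(1)
    by (auto simp: preordered_subgroup_def preordered_subgroup_axioms_def
        intro: additive_subgroup_coordinate_kernel)
  then have "\<exists>g\<in>{x \<in> G. lookup x i = 0} \<inter> P. \<forall>x\<in>{x \<in> G. lookup x i = 0}. \<exists>N::nat. of_nat N * g - x \<in> P"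
    using insert.prems(2) by (intro insert.IH) auto
  then obtain g where g: "g \<in> G" "g \<in> P"
    "\<And>x. x \<in> G \<Longrightarrow> lookup x i = 0 \<Longrightarrow> \<exists>N::nat. of_nat N * g - x \<in> P"
    by blast
  obtain d where d: "d \<in> G" "\<And>x. x \<in> G \<Longrightarrow> \<exists>q. lookup x i = q * lookup d i"
    using subgroup_coordinate_generator additive_subgroup_axioms by blast
  obtain h where h: "h \<in> G" "h \<in> P" "h = d \<or> h = - d"
    using d(1) P_total uminus by metis
  have "\<exists>N::nat. of_nat N * (g + h) - x \<in> P" if x: "x \<in> G" for x
  proof -
    obtain q where q: "lookup x i = q * lookup d i" using d(2)[OF x] by blast
    have "x - of_int q * d \<in> G" using x d by (intro diff of_int_mult)
    from g(3)[OF this] obtain N :: nat where N: "of_nat N * g - (x - of_int q * d) \<in> P"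
      using q by (auto simp: lookup_minus lookup_of_int_mult)
    have "of_int \<bar>q\<bar> * h - of_int q * d = of_int (if h = d then \<bar>q\<bar> - q else \<bar>q\<bar> + q) * h"
      using h(3) by (auto simp: algebra_simps)
    then have "of_int \<bar>q\<bar> * h - of_int q * d \<in> P"
      using P_of_int_mult[OF h(2)] by (simp only:) (auto split: if_splits simp del: of_int_diff of_int_add)
    \<comment> \<open>The last summand tops up the coefficients of \<open>g\<close> and
      \<open>h\<close> to the same number \<open>N + nat \<bar>q\<bar>\<close>.\<close>
    then have "(of_nat N * g - (x - of_int q * d)) + (of_int \<bar>q\<bar> * h - of_int q * d)
        + (of_int \<bar>q\<bar> * g + of_nat N * h) \<in> P"
      using N g(2) h(2) by (intro P_add P_of_int_mult P_of_nat_mult) auto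
    also have "(of_nat N * g - (x - of_int q * d)) + (of_int \<bar>q\<bar> * h - of_int q * d)
        + (of_int \<bar>q\<bar> * g + of_nat N * h) = of_nat (N + nat \<bar>q\<bar>) * (g + h) - x"
      by (simp add: algebra_simps)
    finally show ?thesis by blast
  qed
  moreover have "g + h \<in> G \<inter> P"
    using add[OF g(1) h(1)] P_add[OF g(2) h(2)] by blast
  ultimately show ?case by blast
qed

section \<open>Definability of downsets\<close>

abbreviation (input) definable :: "nat \<Rightarrow> ((nat \<Rightarrow>\<^sub>0 nat) \<Rightarrow> (nat \<Rightarrow>\<^sub>0 nat) \<Rightarrow> bool) set" where
  "definable n \<equiv> boolean_combinations (basic_inequalities n)"

lemmas definable_intros = boolean_combinations.neg boolean_combinations.conj boolean_combinations.disj

lemma definable_const: "(\<lambda>\<alpha> \<beta>. b) \<in> definable n"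
  using boolean_combinations.true boolean_combinations.neg[OF boolean_combinations.true] by (cases b) auto

lemma definable_eq_left:
  assumes "i \<in> {1..n}"
  shows "(\<lambda>\<alpha> \<beta>. lookup \<alpha> i = a) \<in> definable n"
proof -
  \<comment> \<open>For \<open>a = 0\<close> the truncated \<open>a - 1\<close> is again 0; the
    constant conjunct \<open>a \<noteq> 0\<close> switches the lower bound off there.\<close>
  have "(\<lambda>\<alpha> \<beta>. lookup \<alpha> i \<le> a \<and> \<not> (lookup \<alpha> i \<le> a - 1 \<and> a \<noteq> 0)) \<in> definable n"
    by (intro definable_intros definable_const boolean_combinations.basic basic_inequalities.left assms)
  also have "(\<lambda>\<alpha> \<beta>. lookup \<alpha> i \<le> a \<and> \<not> (lookup \<alpha> i \<le> a - 1 \<and> a \<noteq> 0)) =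
      (\<lambda>\<alpha> \<beta> :: nat \<Rightarrow>\<^sub>0 nat. lookup \<alpha> i = a)"
    by (intro ext) auto
  finally show ?thesis .
qed

lemma definable_swap: "Q \<in> definable n \<Longrightarrow> (\<lambda>\<alpha> \<beta>. Q \<beta> \<alpha>) \<in> definable n"
proof (induction rule: boolean_combinations.induct)
  case (basic P)
  then show ?case
  proof (induction rule: basic_inequalities.induct)
    case (linear \<mu> c)
    \<comment> \<open>Exchanging the two sides amounts to negating \<open>\<mu>\<close>.\<close>
    have "(\<lambda>\<alpha> \<beta>. inner_upto n \<beta> \<mu> \<le> inner_upto n \<alpha> \<mu> + c) =
        (\<lambda>\<alpha> \<beta>. inner_upto n \<alpha> (\<lambda>i. - \<mu> i) \<le> inner_upto n \<beta> (\<lambda>i. - \<mu> i) + c)"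
      unfolding inner_upto_def by (intro ext) (simp add: sum_negf, linarith)
    then show ?case by (auto intro: boolean_combinations.basic basic_inequalities.linear)
  qed (blast intro: boolean_combinations.basic basic_inequalities.intros)+
qed (auto intro: boolean_combinations.intros)

lemma definable_eq_right: "i \<in> {1..n} \<Longrightarrow> (\<lambda>\<alpha> \<beta>. lookup \<beta> i = a) \<in> definable n"
  using definable_swap[OF definable_eq_left] by fast

text \<open>Integer valued, since subtraction of exponents in \<open>nat\<close> truncates.\<close>

definition exponent_diff :: "(nat \<Rightarrow>\<^sub>0 nat) \<Rightarrow> (nat \<Rightarrow>\<^sub>0 nat) \<Rightarrow> (nat \<Rightarrow>\<^sub>0 int)" where
  "exponent_diff \<alpha> \<beta> = Poly_Mapping.map int \<alpha> - Poly_Mapping.map int \<beta>"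

lemma lookup_exponent_diff: "lookup (exponent_diff \<alpha> \<beta>) i = int (lookup \<alpha> i) - int (lookup \<beta> i)"
  by (simp add: exponent_diff_def lookup_minus Poly_Mapping.map.rep_eq when_def)

lemma definable_linear_le:
  assumes "S \<subseteq> {1..n}"
  shows "(\<lambda>\<alpha> \<beta>. (\<Sum>i\<in>S. real_of_int (lookup (exponent_diff \<alpha> \<beta> - \<delta>) i) * \<mu> i) \<le> c) \<in> definable n"
proof -
  \<comment> \<open>Padded with 0 because \<open>inner_upto\<close> sums over all of
    \<open>{1..n}\<close>; the contribution of \<open>\<delta>\<close> moves into the
    constant.\<close>
  define \<nu> where "\<nu> i = (if i \<in> S then \<mu> i else 0)" for i
  have inner: "inner_upto n \<alpha> \<nu> = (\<Sum>i\<in>S. real (lookup \<alpha> i) * \<mu> i)" for \<alpha>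
    unfolding inner_upto_def \<nu>_def using assms by (intro sum.mono_neutral_cong_right) auto
  have "((\<Sum>i\<in>S. real_of_int (lookup (exponent_diff \<alpha> \<beta> - \<delta>) i) * \<mu> i) \<le> c) \<longleftrightarrow>
      inner_upto n \<alpha> \<nu> \<le> inner_upto n \<beta> \<nu> + (c + (\<Sum>i\<in>S. real_of_int (lookup \<delta> i) * \<mu> i))" for \<alpha> \<beta>
    unfolding inner
    by (simp add: lookup_minus lookup_exponent_diff left_diff_distrib sum_subtractf sum.distrib algebra_simps)
  then show ?thesis by (simp add: boolean_combinations.basic basic_inequalities.linear)
qed

text \<open>Induction on \<open>card S\<close>, which bounds the rank of \<open>G\<close> modulo
  equivalence, since elements of \<open>G\<close> vanishing on \<open>S\<close> are equivalent to 0.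
  The offset \<open>\<delta>\<close> is arbitrary because the recursion translates a level set of
  the functional into its kernel.\<close>

lemma downset_definable:
  fixes G P D :: "(nat \<Rightarrow>\<^sub>0 int) set"
  assumes "S \<subseteq> {1..n}" "preordered_subgroup G P"
    and "\<And>x. x \<in> G \<Longrightarrow> (\<And>i. i \<in> S \<Longrightarrow> lookup x i = 0) \<Longrightarrow> x \<in> P"
    and "\<And>x y. x \<in> G \<Longrightarrow> y \<in> G \<Longrightarrow> x \<in> D \<Longrightarrow> x - y \<in> P \<Longrightarrow> y \<in> D"
  shows "\<exists>Q\<in>definable n. \<forall>\<alpha> \<beta>. exponent_diff \<alpha> \<beta> - \<delta> \<in> G \<longrightarrow> (exponent_diff \<alpha> \<beta> - \<delta> \<in> D \<longleftrightarrow> Q \<alpha> \<beta>)"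
  using assms
proof (induction "card S" arbitrary: S G D \<delta> rule: less_induct)
  case less
  interpret preordered_subgroup G P by fact
  have "finite S" using less.prems(1) finite_subset by blast
  have const: ?case if "\<And>x. x \<in> G \<Longrightarrow> x \<in> D \<longleftrightarrow> b" for b
    using that definable_const[of b n] by (intro bexI[of _ "\<lambda>\<alpha> \<beta>. b"]) auto
  obtain g where g: "g \<in> G" "g \<in> P" "\<And>x. x \<in> G \<Longrightarrow> \<exists>N::nat. of_nat N * g - x \<in> P"
    using preordered_subgroup_dominant_element[OF \<open>finite S\<close> less.prems(2,3)] by auto
  show ?case
  proof (cases "- g \<in> P")
    \<comment> \<open>All of \<open>G\<close> is then equivalent to 0, so \<open>D\<close> contains
      all of it or nothing.\<close>
    case True
    have "x \<in> P" if x: "x \<in> G" for x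
    proof -
      obtain N :: nat where "of_nat N * g - (- x) \<in> P" using g(3)[OF uminus[OF x]] by blast
      from P_add[OF this P_of_nat_mult[OF True, of N]] show ?thesis by (simp add: algebra_simps)
    qed
    then have "x \<in> D \<longleftrightarrow> y \<in> D" if "x \<in> G" "y \<in> G" for x y
      using less.prems(4) that diff by meson
    then have "x \<in> D \<longleftrightarrow> 0 \<in> D" if "x \<in> G" for x using that zero by blast
    then show ?thesis by (rule const)
  next
    case False
    obtain \<phi> :: "(nat \<Rightarrow>\<^sub>0 int) \<Rightarrow> real" where \<phi>: "\<And>x y. x \<in> G \<Longrightarrow> y \<in> G \<Longrightarrow> \<phi> (x + y) = \<phi> x + \<phi> y"
      "\<And>x. x \<in> G \<Longrightarrow> x \<in> P \<Longrightarrow> \<phi> x \<ge> 0" "\<phi> g > 0"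
      using holder_functional[OF g(1,2) False g(3)] by auto
    have \<phi>_minus: "\<phi> (x - y) = \<phi> x - \<phi> y" if "x \<in> G" "y \<in> G" for x y
      using \<phi>(1)[OF diff[OF that] that(2)] by simp
    have \<phi>_zero: "\<phi> 0 = 0" using \<phi>_minus[OF zero zero] by simp
    \<comment> \<open>Both \<open>x\<close> and \<open>- x\<close> vanish on \<open>S\<close> and
      are therefore nonnegative.\<close>
    have "\<phi> x = 0" if x: "x \<in> G" and "\<And>i. i \<in> S \<Longrightarrow> lookup x i = 0" for x
      using \<phi>(2)[OF x less.prems(3)[OF that]] \<phi>(2)[OF uminus[OF x] less.prems(3)[OF uminus[OF x]]]
        \<phi>_minus[OF zero x] \<phi>_zero that(2) by fastforce
    from additive_functional_representation[OF \<open>finite S\<close> additive_subgroup_axioms \<phi>(1) this]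
    obtain \<mu> where \<mu>: "\<And>x. x \<in> G \<Longrightarrow> \<phi> x = (\<Sum>i\<in>S. real_of_int (lookup x i) * \<mu> i)"
      by blast
    \<comment> \<open>Some coefficient is nonzero because \<open>\<phi> g > 0\<close>. On the
      kernel, coordinate \<open>k\<close> is determined by the others in \<open>S\<close>, so the
      recursion can drop it.\<close>
    obtain k where k: "k \<in> S" "\<mu> k \<noteq> 0"
      using \<mu>[OF g(1)] \<phi>(3) sum.neutral[of S "\<lambda>i. real_of_int (lookup g i) * \<mu> i"] by force
    let ?K = "{x \<in> G. \<phi> x = 0}"
    have K: "preordered_subgroup ?K P"
      by unfold_locales (auto simp: zero diff \<phi>_zero \<phi>_minus P_zero P_add P_total)
    have K_zero: "x \<in> P" if x: "x \<in> ?K" and S: "\<And>i. i \<in> S - {k} \<Longrightarrow> lookup x i = 0" for x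
    proof -
      have "\<phi> x = real_of_int (lookup x k) * \<mu> k"
        using \<mu>[of x] x S k(1) \<open>finite S\<close> by (simp add: sum.remove[of S k])
      then have "lookup x k = 0" using x k by simp
      then show ?thesis using less.prems(3)[of x] x S by blast
    qed
    show ?thesis
    proof (cases "(\<exists>x\<in>G. x \<in> D) \<and> (\<exists>x\<in>G. x \<notin> D)")
      case False
      then show ?thesis using const[of True] const[of False] by blast
    next
      case True
      then obtain x\<^sub>0 x\<^sub>1 where x\<^sub>0: "x\<^sub>0 \<in> G" "x\<^sub>0 \<in> D" and x\<^sub>1: "x\<^sub>1 \<in> G" "x\<^sub>1 \<notin> D" by blast
      have cut: "\<phi> x \<le> \<phi> y" if "x \<in> G" "x \<in> D" "y \<in> G" "y \<notin> D" for x y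
        using P_total[OF diff[of x y]] less.prems(4)[of x y] \<phi>(2)[of "y - x"] \<phi>_minus[of y x] diff[of y x] that
        by auto
      \<comment> \<open>Within \<open>G\<close>, the set \<open>D\<close> contains everything with
        \<open>\<phi>\<close> below \<open>c\<close> and nothing above; only the level
        \<open>\<phi> = c\<close> stays open.\<close>
      define c where "c = Sup (\<phi> ` (G \<inter> D))"
      have bdd: "bdd_above (\<phi> ` (G \<inter> D))" using cut x\<^sub>1 by (auto intro!: bdd_aboveI[of _ "\<phi> x\<^sub>1"])
      have below: "x \<in> D" if x: "x \<in> G" "\<phi> x < c" for x
      proof -
        obtain y where "y \<in> G" "y \<in> D" "\<phi> x < \<phi> y"
          using x(2) less_cSup_iff[OF _ bdd, of "\<phi> x"] x\<^sub>0 unfolding c_def by blast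
        then show ?thesis using cut[of y x] x by force
      qed
      have above: "\<phi> x \<le> c" if "x \<in> G" "x \<in> D" for x
        unfolding c_def using that bdd by (intro cSup_upper) auto
      \<comment> \<open>A base point that moves the level \<open>\<phi> = c\<close> into the kernel.
        If the level is empty any \<open>y\<close> will do, since the recursive formula is then
        never decisive.\<close>
      obtain y where y: "y \<in> G" "(\<exists>x\<in>G. \<phi> x = c) \<Longrightarrow> \<phi> y = c"
        using zero by blast
      have "\<exists>Q\<in>definable n. \<forall>\<alpha> \<beta>. exponent_diff \<alpha> \<beta> - (\<delta> + y) \<in> ?K \<longrightarrow>
          (exponent_diff \<alpha> \<beta> - (\<delta> + y) \<in> {x. x + y \<in> D} \<longleftrightarrow> Q \<alpha> \<beta>)"
      proof (rule less.hyps[of "S - {k}", OF _ _ K K_zero])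
        show "card (S - {k}) < card S" using k(1) \<open>finite S\<close> by (rule card_Diff1_less[rotated])
        show "S - {k} \<subseteq> {1..n}" using less.prems(1) by blast
        fix x z assume "x \<in> ?K" "z \<in> ?K" "x \<in> {x. x + y \<in> D}" "x - z \<in> P"
        then show "z \<in> {x. x + y \<in> D}"
          using less.prems(4)[of "x + y" "z + y"] y(1) add by auto
      qed
      then obtain Q where Q: "Q \<in> definable n" "\<And>\<alpha> \<beta>. exponent_diff \<alpha> \<beta> - (\<delta> + y) \<in> ?K \<Longrightarrow>
          (exponent_diff \<alpha> \<beta> - (\<delta> + y)) + y \<in> D \<longleftrightarrow> Q \<alpha> \<beta>"
        by auto
      let ?\<psi> = "\<lambda>\<alpha> \<beta>. \<Sum>i\<in>S. real_of_int (lookup (exponent_diff \<alpha> \<beta> - \<delta>) i) * \<mu> i"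
      let ?\<psi>' = "\<lambda>\<alpha> \<beta>. \<Sum>i\<in>S. real_of_int (lookup (exponent_diff \<alpha> \<beta> - \<delta>) i) * - \<mu> i"
      have \<psi>': "?\<psi>' \<alpha> \<beta> = - ?\<psi> \<alpha> \<beta>" for \<alpha> \<beta> by (simp add: sum_negf)
      show ?thesis
      proof (intro bexI allI impI)
        \<comment> \<open>Negating the inequality for \<open>?\<psi>'\<close> expresses that
          \<open>?\<psi>\<close> is strictly below \<open>c\<close>; on equality \<open>Q\<close>
          decides.\<close>
        show "(\<lambda>\<alpha> \<beta>. ?\<psi> \<alpha> \<beta> \<le> c \<and> (\<not> ?\<psi>' \<alpha> \<beta> \<le> - c \<or> Q \<alpha> \<beta>)) \<in> definable n"
          by (intro definable_intros definable_linear_le less.prems(1) Q(1))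
        fix \<alpha> \<beta> assume x: "exponent_diff \<alpha> \<beta> - \<delta> \<in> G"
        have "exponent_diff \<alpha> \<beta> - \<delta> \<in> D \<longleftrightarrow> Q \<alpha> \<beta>" if "\<phi> (exponent_diff \<alpha> \<beta> - \<delta>) = c"
        proof -
          have "exponent_diff \<alpha> \<beta> - (\<delta> + y) \<in> ?K"
            using \<phi>_minus[OF x y(1)] diff[OF x y(1)] y(2) x that by (simp add: diff_diff_eq) blast
          from Q(2)[OF this] show ?thesis by simp
        qed
        then show "exponent_diff \<alpha> \<beta> - \<delta> \<in> D \<longleftrightarrow> ?\<psi> \<alpha> \<beta> \<le> c \<and> (\<not> ?\<psi>' \<alpha> \<beta> \<le> - c \<or> Q \<alpha> \<beta>)"
          unfolding \<psi>' \<mu>[OF x, symmetric] using below[OF x] above[OF x]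
          by (cases "\<phi> (exponent_diff \<alpha> \<beta> - \<delta>)" c rule: linorder_cases) auto
      qed
    qed
  qed
qed

section \<open>Exponent vectors\<close>

definition exps :: "nat set \<Rightarrow> (nat \<Rightarrow>\<^sub>0 nat) set" where
  "exps K = {\<alpha>. Poly_Mapping.keys \<alpha> \<subseteq> K}"

lemma exps_iff: "\<alpha> \<in> exps K \<longleftrightarrow> (\<forall>i. i \<notin> K \<longrightarrow> lookup \<alpha> i = 0)"
  by (auto simp: exps_def in_keys_iff)

lemma exps_add_iff [simp]: "\<alpha> + \<beta> \<in> exps K \<longleftrightarrow> \<alpha> \<in> exps K \<and> \<beta> \<in> exps K"
  by (auto simp: exps_iff lookup_add)

lemma exps_zero [simp]: "0 \<in> exps K"
  by (simp add: exps_iff)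

lemma exps_mono: "\<alpha> \<in> exps K \<Longrightarrow> K \<subseteq> L \<Longrightarrow> \<alpha> \<in> exps L"
  by (auto simp: exps_iff)

lemma exps_minus: "\<alpha> \<in> exps K \<Longrightarrow> \<alpha> - \<beta> \<in> exps K"
  by (simp add: exps_iff lookup_minus)

lemma exps_single: "Poly_Mapping.single i c \<in> exps K \<longleftrightarrow> i \<in> K \<or> c = 0"
  by (auto simp: exps_iff lookup_single when_def)

lemma exps_add_minus:
  "\<beta> \<in> exps K \<Longrightarrow> (\<And>i. i \<in> K \<Longrightarrow> lookup \<beta> i \<le> lookup \<alpha> i) \<Longrightarrow> \<beta> + (\<alpha> - \<beta>) = \<alpha>"
  by (rule poly_mapping_eqI) (metis add_diff_inverse_nat exps_iff linorder_not_le lookup_add lookup_minus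
      not_less_zero)

lemma exps_Un:
  assumes "\<gamma> \<in> exps (I \<union> J)"
  obtains \<gamma>\<^sub>I \<gamma>\<^sub>J where "\<gamma>\<^sub>I \<in> exps I" "\<gamma>\<^sub>J \<in> exps J" "\<gamma> = \<gamma>\<^sub>I + \<gamma>\<^sub>J"
proof -
  define \<gamma>\<^sub>I where "\<gamma>\<^sub>I = (\<Sum>i\<in>Poly_Mapping.keys \<gamma> \<inter> I. Poly_Mapping.single i (lookup \<gamma> i))"
  have look: "lookup \<gamma>\<^sub>I i = (if i \<in> I then lookup \<gamma> i else 0)" for i
    by (auto simp: \<gamma>\<^sub>I_def lookup_sum lookup_single when_def in_keys_iff)
  then have "\<gamma>\<^sub>I \<in> exps I" by (simp add: exps_iff)
  moreover have "\<gamma> - \<gamma>\<^sub>I \<in> exps J" using assms by (auto simp: exps_iff lookup_minus look)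
  moreover have "\<gamma> = \<gamma>\<^sub>I + (\<gamma> - \<gamma>\<^sub>I)"
    by (rule poly_mapping_eqI) (simp add: lookup_add lookup_minus look)
  ultimately show thesis by (rule that)
qed

lemma exponent_diff_eq_iff: "exponent_diff \<alpha> \<beta> = exponent_diff \<alpha>' \<beta>' \<longleftrightarrow> \<alpha> + \<beta>' = \<alpha>' + \<beta>"
  unfolding poly_mapping_eq_iff fun_eq_iff lookup_exponent_diff lookup_add
  by (intro iff_allI) linarith

lemma exponent_diff_add: "exponent_diff (\<alpha> + \<alpha>') (\<beta> + \<beta>') = exponent_diff \<alpha> \<beta> + exponent_diff \<alpha>' \<beta>'"
  by (rule poly_mapping_eqI) (simp add: lookup_exponent_diff lookup_add)

lemma exponent_diff_uminus: "- exponent_diff \<alpha> \<beta> = exponent_diff \<beta> \<alpha>"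
  by (simp add: exponent_diff_def)

lemma exponent_diff_exists:
  assumes "\<And>i. i \<notin> K \<Longrightarrow> lookup x i = 0"
  shows "\<exists>\<alpha>\<in>exps K. \<exists>\<beta>\<in>exps K. x = exponent_diff \<alpha> \<beta>"
proof -
  \<comment> \<open>Positive and negative parts, as \<open>nat\<close> sends negative integers to
    0.\<close>
  define \<alpha> where "\<alpha> = Poly_Mapping.map nat x"
  define \<beta> where "\<beta> = Poly_Mapping.map nat (- x)"
  have look: "lookup \<alpha> i = nat (lookup x i)" "lookup \<beta> i = nat (- lookup x i)" for i
    by (auto simp: \<alpha>_def \<beta>_def Poly_Mapping.map.rep_eq when_def)
  have "\<alpha> \<in> exps K" "\<beta> \<in> exps K" using assms by (auto simp: exps_iff look)
  moreover have "x = exponent_diff \<alpha> \<beta>"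
    by (rule poly_mapping_eqI) (simp add: lookup_exponent_diff look)
  ultimately show ?thesis by blast
qed

section \<open>Cancellation\<close>

locale monomial_preorder =
  fixes n :: nat and le :: "(nat \<Rightarrow>\<^sub>0 nat) \<Rightarrow> (nat \<Rightarrow>\<^sub>0 nat) \<Rightarrow> bool"
  assumes preorder: "comm_monoid_preorder (Mon n) le"
begin

definition M :: "(nat \<Rightarrow>\<^sub>0 nat) set" where
  "M = exps {1..n}"

lemma M_add_iff [simp]: "a + b \<in> M \<longleftrightarrow> a \<in> M \<and> b \<in> M"
  by (simp add: M_def)

lemma carrier_Mon: "carrier (Mon n) = M"
  by (simp add: Mon_def exps_def M_def)

lemma le_refl: "a \<in> M \<Longrightarrow> le a a"
  using comm_monoid_preorder.refl[OF preorder] by (simp add: carrier_Mon reflp_on_def)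

lemma le_trans: "le a b \<Longrightarrow> le b c \<Longrightarrow> a \<in> M \<Longrightarrow> b \<in> M \<Longrightarrow> c \<in> M \<Longrightarrow> le a c"
  by (rule transp_onD[OF comm_monoid_preorder.trans[OF preorder]]) (simp_all add: carrier_Mon)

lemma le_linear: "a \<in> M \<Longrightarrow> b \<in> M \<Longrightarrow> le a b \<or> le b a"
  using totalp_onD[OF comm_monoid_preorder.total[OF preorder], of a b] le_refl[of a]
  by (auto simp: carrier_Mon)

lemma le_add: "le a b \<Longrightarrow> c \<in> M \<Longrightarrow> a \<in> M \<Longrightarrow> b \<in> M \<Longrightarrow> le (a + c) (b + c)"
  using comm_monoid_preorder.mult_mono[OF preorder, of c a b]
  by (simp add: carrier_Mon) (simp add: Mon_def add.commute)

text \<open>The total preorder obtained from \<open>le\<close> by making the variables in \<open>K\<close> cancellable.\<close>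
definition sle :: "nat set \<Rightarrow> (nat \<Rightarrow>\<^sub>0 nat) \<Rightarrow> (nat \<Rightarrow>\<^sub>0 nat) \<Rightarrow> bool" where
  "sle K a b \<longleftrightarrow> (\<exists>\<gamma>\<in>exps K. le (a + \<gamma>) (b + \<gamma>))"

context
  fixes K :: "nat set"
  assumes K: "K \<subseteq> {1..n}"
begin

lemma exps_M: "a \<in> exps K \<Longrightarrow> a \<in> M"
  using exps_mono K by (simp only: M_def)

lemma sle_if_le: "le a b \<Longrightarrow> sle K a b"
  unfolding sle_def by (intro bexI[of _ 0]) auto

lemma sle_linear: "a \<in> M \<Longrightarrow> b \<in> M \<Longrightarrow> sle K a b \<or> sle K b a"
  using le_linear sle_if_le by blast

lemma sle_trans:
  assumes "sle K a b" "sle K b c" "a \<in> M" "b \<in> M" "c \<in> M"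
  shows "sle K a c"
proof -
  obtain \<gamma> \<gamma>' where \<gamma>: "\<gamma> \<in> exps K" "le (a + \<gamma>) (b + \<gamma>)" "\<gamma>' \<in> exps K" "le (b + \<gamma>') (c + \<gamma>')"
    using assms(1,2) by (auto simp: sle_def)
  have "le (a + \<gamma> + \<gamma>') (b + \<gamma> + \<gamma>')" "le (b + \<gamma>' + \<gamma>) (c + \<gamma>' + \<gamma>)"
    using \<gamma> assms(3-5) by (auto intro!: le_add simp: exps_M)
  then have "le (a + (\<gamma> + \<gamma>')) (c + (\<gamma> + \<gamma>'))"
    using \<gamma> assms(3-5) by (auto intro: le_trans[of _ "b + \<gamma> + \<gamma>'"] simp: exps_M ac_simps)
  then show ?thesis using \<gamma> unfolding sle_def by (intro bexI[of _ "\<gamma> + \<gamma>'"]) auto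
qed

lemma sle_add:
  assumes "sle K a b" "a \<in> M" "b \<in> M" "c \<in> M"
  shows "sle K (a + c) (b + c)"
proof -
  obtain \<gamma> where \<gamma>: "\<gamma> \<in> exps K" "le (a + \<gamma>) (b + \<gamma>)" using assms(1) by (auto simp: sle_def)
  have "le (a + \<gamma> + c) (b + \<gamma> + c)" using \<gamma> assms by (auto intro!: le_add simp: exps_M)
  then show ?thesis using \<gamma>(1) unfolding sle_def by (intro bexI[of _ \<gamma>]) (auto simp: ac_simps)
qed

text \<open>The cancelled exponent is absorbed into the witness.\<close>

lemma sle_cancel:
  assumes "sle K (a + c) (b + c)" "c \<in> exps K"
  shows "sle K a b"
proof -
  obtain \<gamma> where \<gamma>: "\<gamma> \<in> exps K" "le (a + c + \<gamma>) (b + c + \<gamma>)" using assms(1) by (auto simp: sle_def)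
  then show ?thesis
    using assms(2) unfolding sle_def by (intro bexI[of _ "c + \<gamma>"]) (auto simp: ac_simps)
qed

lemma sle_definable:
  assumes u: "u \<in> M" and v: "v \<in> M"
  shows "\<exists>Q\<in>definable n. \<forall>\<alpha>\<in>exps K. \<forall>\<beta>\<in>exps K. sle K (u + \<alpha>) (v + \<beta>) \<longleftrightarrow> Q (u + \<alpha>) (v + \<beta>)"
proof -
  define G :: "(nat \<Rightarrow>\<^sub>0 int) set" where "G = {x. \<forall>i. i \<notin> K \<longrightarrow> lookup x i = 0}"
  \<comment> \<open>Nonnegativity is tested over \<open>u\<close>, because moving down in
    \<open>D\<close> compares left-hand sides \<open>u + \<alpha>\<close>. The base point may
    involve variables outside \<open>K\<close> and cannot be cancelled in general.\<close>
  define P where "P = {exponent_diff \<alpha> \<beta> |\<alpha> \<beta>. \<alpha> \<in> exps K \<and> \<beta> \<in> exps K \<and> sle K (u + \<beta>) (u + \<alpha>)}"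
  define D where "D = {exponent_diff \<alpha> \<beta> |\<alpha> \<beta>. \<alpha> \<in> exps K \<and> \<beta> \<in> exps K \<and> sle K (u + \<alpha>) (v + \<beta>)}"
  have PI: "exponent_diff \<alpha> \<beta> \<in> P"
    if "\<alpha> \<in> exps K" "\<beta> \<in> exps K" "sle K (u + \<beta>) (u + \<alpha>)" for \<alpha> \<beta> using that by (auto simp: P_def)
  have DI: "exponent_diff \<alpha> \<beta> \<in> D"
    if "\<alpha> \<in> exps K" "\<beta> \<in> exps K" "sle K (u + \<alpha>) (v + \<beta>)" for \<alpha> \<beta> using that by (auto simp: D_def)
  have G_ex: "\<exists>\<alpha>\<in>exps K. \<exists>\<beta>\<in>exps K. x = exponent_diff \<alpha> \<beta>" if "x \<in> G" for x
    using that by (intro exponent_diff_exists) (simp add: G_def)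
  have G_diff: "exponent_diff \<alpha> \<beta> \<in> G" if "\<alpha> \<in> exps K" "\<beta> \<in> exps K" for \<alpha> \<beta>
    using that by (auto simp: G_def exps_iff lookup_exponent_diff)
  have P_zero: "0 \<in> P"
    using PI[of 0 0] le_refl[OF u] sle_if_le by (simp add: exponent_diff_def)
  have sub: "preordered_subgroup G P"
  proof
    show "0 \<in> G" "\<And>x y. x \<in> G \<Longrightarrow> y \<in> G \<Longrightarrow> x - y \<in> G"
      by (auto simp: G_def lookup_minus)
    show "0 \<in> P" by fact
  next
    fix x y assume "x \<in> P" "y \<in> P"
    then obtain \<alpha> \<beta> \<alpha>' \<beta>' where x: "x = exponent_diff \<alpha> \<beta>" "\<alpha> \<in> exps K" "\<beta> \<in> exps K" "sle K (u + \<beta>) (u + \<alpha>)"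
      and y: "y = exponent_diff \<alpha>' \<beta>'" "\<alpha>' \<in> exps K" "\<beta>' \<in> exps K" "sle K (u + \<beta>') (u + \<alpha>')"
      by (auto simp: P_def)
    have "sle K (u + \<beta> + \<beta>') (u + \<alpha> + \<beta>')" "sle K (u + \<beta>' + \<alpha>) (u + \<alpha>' + \<alpha>)"
      using x y u by (auto intro!: sle_add simp: exps_M)
    then have "sle K (u + (\<beta> + \<beta>')) (u + (\<alpha> + \<alpha>'))"
      using x y u by (auto intro: sle_trans[of _ "u + \<alpha> + \<beta>'"] simp: exps_M ac_simps)
    then show "x + y \<in> P" using x y PI[of "\<alpha> + \<alpha>'" "\<beta> + \<beta>'"] by (simp add: exponent_diff_add)
  next
    fix x assume "x \<in> G"
    then obtain \<alpha> \<beta> where x: "\<alpha> \<in> exps K" "\<beta> \<in> exps K" "x = exponent_diff \<alpha> \<beta>" using G_ex by blast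
    then show "x \<in> P \<or> - x \<in> P"
      using sle_linear[of "u + \<alpha>" "u + \<beta>"] PI[of \<alpha> \<beta>] PI[of \<beta> \<alpha>] u
      by (auto simp: exponent_diff_uminus exps_M)
  qed
  have zero: "x \<in> P" if "x \<in> G" "\<And>i. i \<in> K \<Longrightarrow> lookup x i = 0" for x
  proof -
    have "x = 0" using that by (intro poly_mapping_eqI) (auto simp: G_def)
    then show ?thesis using P_zero by simp
  qed
  have down: "y \<in> D" if "x \<in> D" "x - y \<in> P" for x y
  proof -
    obtain \<alpha> \<beta> where x: "x = exponent_diff \<alpha> \<beta>" "\<alpha> \<in> exps K" "\<beta> \<in> exps K" "sle K (u + \<alpha>) (v + \<beta>)"
      using \<open>x \<in> D\<close> by (auto simp: D_def)
    obtain \<alpha>' \<beta>' where xy: "x - y = exponent_diff \<alpha>' \<beta>'" "\<alpha>' \<in> exps K" "\<beta>' \<in> exps K"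
      "sle K (u + \<beta>') (u + \<alpha>')"
      using \<open>x - y \<in> P\<close> by (auto simp: P_def)
    \<comment> \<open>Chaining these two through \<open>u + \<alpha>' + \<alpha>\<close> represents
      \<open>y\<close> by the pair \<open>\<alpha> + \<beta>'\<close>,
      \<open>\<beta> + \<alpha>'\<close>.\<close>
    have "sle K (u + \<beta>' + \<alpha>) (u + \<alpha>' + \<alpha>)" "sle K (u + \<alpha> + \<alpha>') (v + \<beta> + \<alpha>')"
      using x xy u v by (auto intro!: sle_add simp: exps_M)
    then have "sle K (u + (\<alpha> + \<beta>')) (v + (\<beta> + \<alpha>'))"
      using x xy u v by (auto intro: sle_trans[of _ "u + \<alpha>' + \<alpha>"] simp: exps_M ac_simps)
    then have "exponent_diff (\<alpha> + \<beta>') (\<beta> + \<alpha>') \<in> D" using x xy by (intro DI) auto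
    moreover have "y = x - exponent_diff \<alpha>' \<beta>'" using xy(1) by (simp add: algebra_simps)
    ultimately show ?thesis
      by (simp add: x(1) exponent_diff_add flip: exponent_diff_uminus[of \<alpha>' \<beta>'])
  qed
  \<comment> \<open>The offset compensates for the base points: \<open>Q\<close> is applied to
    \<open>u + \<alpha>\<close> and \<open>v + \<beta>\<close>, while \<open>D\<close> concerns the
    difference of \<open>\<alpha>\<close> and \<open>\<beta>\<close>.\<close>
  have "\<exists>Q\<in>definable n. \<forall>\<alpha> \<beta>. exponent_diff \<alpha> \<beta> - exponent_diff u v \<in> G \<longrightarrow>
      (exponent_diff \<alpha> \<beta> - exponent_diff u v \<in> D \<longleftrightarrow> Q \<alpha> \<beta>)"
    by (rule downset_definable[OF K sub]) (blast intro: zero down)+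
  then obtain Q where Q: "Q \<in> definable n"
    "\<And>\<alpha> \<beta>. exponent_diff \<alpha> \<beta> - exponent_diff u v \<in> G \<Longrightarrow>
      exponent_diff \<alpha> \<beta> - exponent_diff u v \<in> D \<longleftrightarrow> Q \<alpha> \<beta>"
    by blast
  \<comment> \<open>Membership in \<open>D\<close> yields some representation of the difference;
    adding \<open>\<beta>\<close> and cancelling \<open>\<beta>'\<close> passes to the given
    one.\<close>
  have "sle K (u + \<alpha>) (v + \<beta>) \<longleftrightarrow> exponent_diff \<alpha> \<beta> \<in> D" if \<alpha>\<beta>: "\<alpha> \<in> exps K" "\<beta> \<in> exps K" for \<alpha> \<beta>
  proof
    assume "exponent_diff \<alpha> \<beta> \<in> D"
    then obtain \<alpha>' \<beta>' where \<alpha>': "\<alpha> + \<beta>' = \<alpha>' + \<beta>" "\<alpha>' \<in> exps K" "\<beta>' \<in> exps K" "sle K (u + \<alpha>') (v + \<beta>')"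
      by (auto simp: D_def exponent_diff_eq_iff)
    have "sle K (u + \<alpha>' + \<beta>) (v + \<beta>' + \<beta>)" using \<alpha>' \<alpha>\<beta> u v by (auto intro!: sle_add simp: exps_M)
    then have "sle K (u + \<alpha> + \<beta>') (v + \<beta> + \<beta>')" by (metis \<alpha>'(1) add.assoc add.commute)
    then show "sle K (u + \<alpha>) (v + \<beta>)" by (rule sle_cancel) fact
  qed (simp add: DI \<alpha>\<beta>)
  then show ?thesis
    using Q(2)[of "u + _" "v + _"] G_diff by (intro bexI[OF _ Q(1)]) (simp add: exponent_diff_add)
qed

end

end

section \<open>Uniform witnesses for equivalence\<close>

text \<open>A pair of vectors over \<open>K\<close> is one vector over \<open>K <+> K\<close>.
  Domination is restated as a decomposition, ready for dividing relations.\<close>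

lemma dickson_exps_pairs:
  assumes "finite K" "A \<subseteq> exps K \<times> exps K"
  obtains F where "finite F" "F \<subseteq> A"
    "\<And>\<alpha> \<beta>. (\<alpha>, \<beta>) \<in> A \<Longrightarrow> \<exists>\<alpha>\<^sub>0 \<beta>\<^sub>0 \<alpha>' \<beta>'. (\<alpha>\<^sub>0, \<beta>\<^sub>0) \<in> F \<and> \<alpha>' \<in> exps K \<and> \<beta>' \<in> exps K \<and>
      \<alpha> = \<alpha>\<^sub>0 + \<alpha>' \<and> \<beta> = \<beta>\<^sub>0 + \<beta>'"
proof -
  have "finite (K <+> K)" using assms(1) by simp
  from dickson[OF this, of A "\<lambda>(\<alpha>, \<beta>). case_sum (lookup \<alpha>) (lookup \<beta>)"]
  obtain F where F: "finite F" "F \<subseteq> A" and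
    le: "\<forall>a\<in>A. \<exists>b\<in>F. \<forall>i\<in>K <+> K. (case b of (\<alpha>, \<beta>) \<Rightarrow> case_sum (lookup \<alpha>) (lookup \<beta>)) i
      \<le> (case a of (\<alpha>, \<beta>) \<Rightarrow> case_sum (lookup \<alpha>) (lookup \<beta>)) i"
    by blast
  have quotient: "\<exists>\<alpha>\<^sub>0 \<beta>\<^sub>0 \<alpha>' \<beta>'. (\<alpha>\<^sub>0, \<beta>\<^sub>0) \<in> F \<and> \<alpha>' \<in> exps K \<and> \<beta>' \<in> exps K \<and>
      \<alpha> = \<alpha>\<^sub>0 + \<alpha>' \<and> \<beta> = \<beta>\<^sub>0 + \<beta>'"
    if \<alpha>\<beta>: "(\<alpha>, \<beta>) \<in> A" for \<alpha> \<beta>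
  proof -
    obtain \<alpha>\<^sub>0 \<beta>\<^sub>0 where 0: "(\<alpha>\<^sub>0, \<beta>\<^sub>0) \<in> F"
      "\<forall>i\<in>K <+> K. case_sum (lookup \<alpha>\<^sub>0) (lookup \<beta>\<^sub>0) i \<le> case_sum (lookup \<alpha>) (lookup \<beta>) i"
      using bspec[OF le \<alpha>\<beta>] by auto
    have "\<alpha>\<^sub>0 + (\<alpha> - \<alpha>\<^sub>0) = \<alpha>" "\<beta>\<^sub>0 + (\<beta> - \<beta>\<^sub>0) = \<beta>"
      using bspec[OF 0(2), of "Inl _"] bspec[OF 0(2), of "Inr _"] 0(1) F(2) assms(2)
      by (auto intro!: exps_add_minus[where K = K])
    moreover have "\<alpha> - \<alpha>\<^sub>0 \<in> exps K" "\<beta> - \<beta>\<^sub>0 \<in> exps K"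
      using \<alpha>\<beta> assms(2) by (auto intro: exps_minus)
    ultimately show ?thesis using 0(1) by metis
  qed
  show thesis by (rule that[OF F quotient])
qed

context monomial_preorder
begin

definition eqv :: "(nat \<Rightarrow>\<^sub>0 nat) \<Rightarrow> (nat \<Rightarrow>\<^sub>0 nat) \<Rightarrow> bool" where
  "eqv a b \<longleftrightarrow> le a b \<and> le b a"

definition seqv :: "nat set \<Rightarrow> (nat \<Rightarrow>\<^sub>0 nat) \<Rightarrow> (nat \<Rightarrow>\<^sub>0 nat) \<Rightarrow> bool" where
  "seqv K a b \<longleftrightarrow> sle K a b \<and> sle K b a"

lemma eqv_trans: "eqv a b \<Longrightarrow> eqv b c \<Longrightarrow> a \<in> M \<Longrightarrow> b \<in> M \<Longrightarrow> c \<in> M \<Longrightarrow> eqv a c"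
  using le_trans[of a b c] le_trans[of c b a] by (simp add: eqv_def)

lemma eqv_add: "eqv a b \<Longrightarrow> c \<in> M \<Longrightarrow> a \<in> M \<Longrightarrow> b \<in> M \<Longrightarrow> eqv (a + c) (b + c)"
  by (simp add: eqv_def le_add)

context
  fixes K :: "nat set"
  assumes K: "K \<subseteq> {1..n}"
begin

lemma seqv_trans: "seqv K a b \<Longrightarrow> seqv K b c \<Longrightarrow> a \<in> M \<Longrightarrow> b \<in> M \<Longrightarrow> c \<in> M \<Longrightarrow> seqv K a c"
  using sle_trans[OF K, of a b c] sle_trans[OF K, of c b a] by (simp add: seqv_def)

lemma seqv_sym: "seqv K a b \<Longrightarrow> seqv K b a"
  by (simp add: seqv_def)

lemma seqv_add: "seqv K a b \<Longrightarrow> a \<in> M \<Longrightarrow> b \<in> M \<Longrightarrow> c \<in> M \<Longrightarrow> seqv K (a + c) (b + c)"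
  using sle_add[OF K] by (simp add: seqv_def)

lemma seqv_cancel: "seqv K (a + c) (b + c) \<Longrightarrow> c \<in> exps K \<Longrightarrow> seqv K a b"
  using sle_cancel[OF K, of a c b] sle_cancel[OF K, of b c a] by (simp add: seqv_def)

lemma seqv_witness:
  assumes "seqv K a b" "a \<in> M" "b \<in> M"
  shows "\<exists>\<gamma>\<in>exps K. eqv (a + \<gamma>) (b + \<gamma>)"
proof -
  obtain \<gamma> \<gamma>' where \<gamma>: "\<gamma> \<in> exps K" "le (a + \<gamma>) (b + \<gamma>)" "\<gamma>' \<in> exps K" "le (b + \<gamma>') (a + \<gamma>')"
    using assms(1) by (auto simp: seqv_def sle_def)
  have "le (a + \<gamma> + \<gamma>') (b + \<gamma> + \<gamma>')" "le (b + \<gamma>' + \<gamma>) (a + \<gamma>' + \<gamma>)"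
    using \<gamma> assms(2,3) by (auto intro!: le_add simp: exps_M[OF K])
  then show ?thesis using \<gamma> by (intro bexI[of _ "\<gamma> + \<gamma>'"]) (auto simp: eqv_def ac_simps)
qed

text \<open>Witnesses for the single pairs add up, because \<open>eqv\<close> survives adding
  further exponents.\<close>

lemma seqv_finite_witness:
  assumes "finite F" "u \<in> M" "v \<in> M"
    and "\<And>\<alpha> \<beta>. (\<alpha>, \<beta>) \<in> F \<Longrightarrow> \<alpha> \<in> exps K \<and> \<beta> \<in> exps K \<and> seqv K (u + \<alpha>) (v + \<beta>)"
  shows "\<exists>\<gamma>\<in>exps K. \<forall>(\<alpha>, \<beta>)\<in>F. eqv (u + \<alpha> + \<gamma>) (v + \<beta> + \<gamma>)"
  using assms(1,4)
proof (induction F rule: finite_induct)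
  case empty
  show ?case by (rule bexI[of _ 0]) simp_all
next
  case (insert p F)
  obtain \<alpha>\<^sub>0 \<beta>\<^sub>0 where p: "p = (\<alpha>\<^sub>0, \<beta>\<^sub>0)" by force
  obtain \<gamma> where \<gamma>: "\<gamma> \<in> exps K" "\<forall>(\<alpha>, \<beta>)\<in>F. eqv (u + \<alpha> + \<gamma>) (v + \<beta> + \<gamma>)"
    using insert.IH insert.prems by blast
  obtain \<gamma>' where \<gamma>': "\<gamma>' \<in> exps K" "eqv (u + \<alpha>\<^sub>0 + \<gamma>') (v + \<beta>\<^sub>0 + \<gamma>')"
    using seqv_witness[of "u + \<alpha>\<^sub>0" "v + \<beta>\<^sub>0"] insert.prems[of \<alpha>\<^sub>0 \<beta>\<^sub>0] assms(2,3) p by (auto simp: exps_M[OF K])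
  have "eqv (u + \<alpha> + (\<gamma> + \<gamma>')) (v + \<beta> + (\<gamma> + \<gamma>'))" if \<alpha>\<beta>: "(\<alpha>, \<beta>) \<in> insert p F" for \<alpha> \<beta>
  proof -
    have M: "\<alpha> \<in> M" "\<beta> \<in> M" using insert.prems[OF \<alpha>\<beta>] by (auto intro: exps_M[OF K])
    consider "\<alpha> = \<alpha>\<^sub>0" "\<beta> = \<beta>\<^sub>0" | "(\<alpha>, \<beta>) \<in> F" using \<alpha>\<beta> p by blast
    then show ?thesis
    proof cases
      case 1
      then show ?thesis
        using eqv_add[OF \<gamma>'(2), of \<gamma>] M assms(2,3) \<gamma> \<gamma>'(1) by (simp add: exps_M[OF K] ac_simps)
    next
      case 2
      then have "eqv (u + \<alpha> + \<gamma>) (v + \<beta> + \<gamma>)" using \<gamma>(2) by blast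
      from eqv_add[OF this, of \<gamma>'] show ?thesis
        using M assms(2,3) \<gamma>(1) \<gamma>'(1) by (simp add: exps_M[OF K] ac_simps)
    qed
  qed
  then show ?case using \<gamma>(1) \<gamma>'(1) by (intro bexI[of _ "\<gamma> + \<gamma>'"]) auto
qed

text \<open>Both \<open>v + \<beta>\<^sub>0 + \<alpha>'\<close> and
  \<open>v + \<beta>\<^sub>0 + \<beta>'\<close> are equivalent to
  \<open>u + \<alpha>\<^sub>0 + \<alpha>'\<close>, and \<open>\<beta>\<^sub>0\<close> cancels. The
  quotient of two relations thus lives over \<open>v\<close> alone, which is why the case
  \<open>u = v\<close> is settled first below.\<close>

lemma seqv_quotient:
  assumes "u \<in> M" "v \<in> M" "\<alpha>\<^sub>0 \<in> exps K" "\<beta>\<^sub>0 \<in> exps K" "\<alpha>' \<in> exps K" "\<beta>' \<in> exps K"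
    and "seqv K (u + \<alpha>\<^sub>0) (v + \<beta>\<^sub>0)" "seqv K (u + (\<alpha>\<^sub>0 + \<alpha>')) (v + (\<beta>\<^sub>0 + \<beta>'))"
  shows "seqv K (v + \<alpha>') (v + \<beta>')"
proof -
  have 1: "seqv K (u + \<alpha>\<^sub>0 + \<alpha>') (v + \<beta>\<^sub>0 + \<alpha>')"
    using assms by (intro seqv_add[OF assms(7)]) (auto simp: exps_M[OF K])
  have 2: "seqv K (u + \<alpha>\<^sub>0 + \<alpha>') (v + \<beta>\<^sub>0 + \<beta>')"
    using assms(8) by (simp add: add.assoc)
  have "seqv K (v + \<beta>\<^sub>0 + \<alpha>') (v + \<beta>\<^sub>0 + \<beta>')"
    using seqv_trans[OF seqv_sym[OF 1] 2] assms(1-6) by (simp add: exps_M[OF K])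
  then have "seqv K (v + \<alpha>' + \<beta>\<^sub>0) (v + \<beta>' + \<beta>\<^sub>0)"
    by (simp add: add.assoc add.commute[of \<beta>\<^sub>0])
  then show ?thesis using assms(4) by (rule seqv_cancel)
qed

text \<open>Reverses the division, passing through
  \<open>v + \<beta>\<^sub>0 + \<gamma> + \<alpha>'\<close>. The point is that the same
  \<open>\<gamma>\<close> serves again, so repeated composition does not enlarge the
  witness.\<close>

lemma eqv_compose:
  assumes "u \<in> M" "v \<in> M" "\<gamma> \<in> exps K" "\<alpha>\<^sub>0 \<in> exps K" "\<beta>\<^sub>0 \<in> exps K" "\<alpha>' \<in> exps K" "\<beta>' \<in> exps K"
    and "eqv (u + \<alpha>\<^sub>0 + \<gamma>) (v + \<beta>\<^sub>0 + \<gamma>)" "eqv (v + \<alpha>' + \<gamma>) (v + \<beta>' + \<gamma>)"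
  shows "eqv (u + (\<alpha>\<^sub>0 + \<alpha>') + \<gamma>) (v + (\<beta>\<^sub>0 + \<beta>') + \<gamma>)"
proof -
  have 1: "eqv (u + \<alpha>\<^sub>0 + \<gamma> + \<alpha>') (v + \<beta>\<^sub>0 + \<gamma> + \<alpha>')"
    using assms by (intro eqv_add[OF assms(8)]) (auto simp: exps_M[OF K])
  have "eqv (v + \<alpha>' + \<gamma> + \<beta>\<^sub>0) (v + \<beta>' + \<gamma> + \<beta>\<^sub>0)"
    using assms by (intro eqv_add[OF assms(9)]) (auto simp: exps_M[OF K])
  then have 2: "eqv (v + \<beta>\<^sub>0 + \<gamma> + \<alpha>') (v + (\<beta>\<^sub>0 + \<beta>') + \<gamma>)"
    by (simp add: ac_simps)
  have "eqv (u + \<alpha>\<^sub>0 + \<gamma> + \<alpha>') (v + (\<beta>\<^sub>0 + \<beta>') + \<gamma>)"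
    using eqv_trans[OF 1 2] assms(1-7) by (simp add: exps_M[OF K])
  then show ?thesis by (simp add: ac_simps)
qed

text \<open>Over a single base point, relations are closed under division, so each is composed of
  finitely many Dickson generators, and a witness for the generators serves all.\<close>

lemma seqv_uniform_witness_same:
  assumes v: "v \<in> M"
  shows "\<exists>\<gamma>\<in>exps K. \<forall>\<alpha>\<in>exps K. \<forall>\<beta>\<in>exps K. seqv K (v + \<alpha>) (v + \<beta>) \<longrightarrow> eqv (v + \<alpha> + \<gamma>) (v + \<beta> + \<gamma>)"
proof -
  have "finite K" using K finite_subset by blast
  \<comment> \<open>Leaving out the trivial pair gives every generator positive total degree
    \<open>d\<close>, so division by it strictly lowers the degree.\<close>
  define A where "A = {(\<alpha>, \<beta>). \<alpha> \<in> exps K \<and> \<beta> \<in> exps K \<and> seqv K (v + \<alpha>) (v + \<beta>)} - {(0, 0)}"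
  have AD: "\<alpha> \<in> exps K \<and> \<beta> \<in> exps K \<and> seqv K (v + \<alpha>) (v + \<beta>)" if "(\<alpha>, \<beta>) \<in> A" for \<alpha> \<beta>
    using that by (simp add: A_def)
  have "A \<subseteq> exps K \<times> exps K" by (auto simp: A_def)
  then obtain F where F: "finite F" "F \<subseteq> A"
    "\<And>\<alpha> \<beta>. (\<alpha>, \<beta>) \<in> A \<Longrightarrow> \<exists>\<alpha>\<^sub>0 \<beta>\<^sub>0 \<alpha>' \<beta>'. (\<alpha>\<^sub>0, \<beta>\<^sub>0) \<in> F \<and> \<alpha>' \<in> exps K \<and> \<beta>' \<in> exps K \<and>
      \<alpha> = \<alpha>\<^sub>0 + \<alpha>' \<and> \<beta> = \<beta>\<^sub>0 + \<beta>'"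
    by (rule dickson_exps_pairs[OF \<open>finite K\<close>]) (rule that)
  have "\<exists>\<gamma>\<in>exps K. \<forall>(\<alpha>, \<beta>)\<in>F. eqv (v + \<alpha> + \<gamma>) (v + \<beta> + \<gamma>)"
    using F(1) v v by (rule seqv_finite_witness) (use F(2) AD in blast)
  then obtain \<gamma> where \<gamma>: "\<gamma> \<in> exps K" "\<And>\<alpha> \<beta>. (\<alpha>, \<beta>) \<in> F \<Longrightarrow> eqv (v + \<alpha> + \<gamma>) (v + \<beta> + \<gamma>)"
    by blast
  define d where "d \<alpha> = (\<Sum>i\<in>K. lookup \<alpha> i)" for \<alpha> :: "nat \<Rightarrow>\<^sub>0 nat"
  have d_add: "d (\<alpha> + \<beta>) = d \<alpha> + d \<beta>" for \<alpha> \<beta> by (simp add: d_def lookup_add sum.distrib)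
  have d_zero: "\<alpha> = 0" if "\<alpha> \<in> exps K" "d \<alpha> = 0" for \<alpha>
    using that \<open>finite K\<close> by (intro poly_mapping_eqI) (auto simp: d_def exps_iff)
  have "eqv (v + \<alpha> + \<gamma>) (v + \<beta> + \<gamma>)" if "\<alpha> \<in> exps K" "\<beta> \<in> exps K" "seqv K (v + \<alpha>) (v + \<beta>)" for \<alpha> \<beta>
    using that
  proof (induction "d \<alpha> + d \<beta>" arbitrary: \<alpha> \<beta> rule: less_induct)
    case less
    show ?case
    proof (cases "(\<alpha>, \<beta>) = (0, 0)")
      case True
      then show ?thesis using le_refl[of "v + \<gamma>"] v \<gamma>(1) by (simp add: eqv_def exps_M[OF K])
    next
      case False
      then have "(\<alpha>, \<beta>) \<in> A" using less.prems by (simp add: A_def)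
      from F(3)[OF this] obtain \<alpha>\<^sub>0 \<beta>\<^sub>0 \<alpha>' \<beta>' where 0: "(\<alpha>\<^sub>0, \<beta>\<^sub>0) \<in> F" "\<alpha>' \<in> exps K" "\<beta>' \<in> exps K"
        "\<alpha> = \<alpha>\<^sub>0 + \<alpha>'" "\<beta> = \<beta>\<^sub>0 + \<beta>'"
        by blast
      have A0: "(\<alpha>\<^sub>0, \<beta>\<^sub>0) \<in> A" using 0(1) F(2) by blast
      then have "d \<alpha>\<^sub>0 + d \<beta>\<^sub>0 > 0" using AD[OF A0] d_zero by (auto simp: A_def)
      then have less': "d \<alpha>' + d \<beta>' < d \<alpha> + d \<beta>" by (simp add: 0 d_add)
      have "seqv K (v + \<alpha>') (v + \<beta>')"
        using AD[OF A0] 0 less.prems v seqv_quotient[of v v \<alpha>\<^sub>0 \<beta>\<^sub>0 \<alpha>' \<beta>'] by simp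
      from less.hyps[OF less' 0(2,3) this] show ?thesis
        unfolding 0 using v \<gamma> AD[OF A0] 0 by (intro eqv_compose) auto
    qed
  qed
  then show ?thesis using \<gamma>(1) by blast
qed

text \<open>A relation between \<open>u\<close> and \<open>v\<close> is a single generator followed
  by a relation over \<open>v\<close>, so one division suffices and the two witnesses are
  added.\<close>

lemma seqv_uniform_witness:
  assumes u: "u \<in> M" and v: "v \<in> M"
  shows "\<exists>\<gamma>\<in>exps K. \<forall>\<alpha>\<in>exps K. \<forall>\<beta>\<in>exps K. seqv K (u + \<alpha>) (v + \<beta>) \<longrightarrow> eqv (u + \<alpha> + \<gamma>) (v + \<beta> + \<gamma>)"
proof -
  have "finite K" using K finite_subset by blast
  define A where "A = {(\<alpha>, \<beta>). \<alpha> \<in> exps K \<and> \<beta> \<in> exps K \<and> seqv K (u + \<alpha>) (v + \<beta>)}"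
  have AD: "\<alpha> \<in> exps K \<and> \<beta> \<in> exps K \<and> seqv K (u + \<alpha>) (v + \<beta>)" if "(\<alpha>, \<beta>) \<in> A" for \<alpha> \<beta>
    using that by (simp add: A_def)
  have "A \<subseteq> exps K \<times> exps K" by (auto simp: A_def)
  then obtain F where F: "finite F" "F \<subseteq> A"
    "\<And>\<alpha> \<beta>. (\<alpha>, \<beta>) \<in> A \<Longrightarrow> \<exists>\<alpha>\<^sub>0 \<beta>\<^sub>0 \<alpha>' \<beta>'. (\<alpha>\<^sub>0, \<beta>\<^sub>0) \<in> F \<and> \<alpha>' \<in> exps K \<and> \<beta>' \<in> exps K \<and>
      \<alpha> = \<alpha>\<^sub>0 + \<alpha>' \<and> \<beta> = \<beta>\<^sub>0 + \<beta>'"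
    by (rule dickson_exps_pairs[OF \<open>finite K\<close>]) (rule that)
  have "\<exists>\<gamma>\<in>exps K. \<forall>(\<alpha>, \<beta>)\<in>F. eqv (u + \<alpha> + \<gamma>) (v + \<beta> + \<gamma>)"
    using F(1) u v by (rule seqv_finite_witness) (use F(2) AD in blast)
  then obtain \<gamma>\<^sub>1 where \<gamma>\<^sub>1: "\<gamma>\<^sub>1 \<in> exps K" "\<And>\<alpha> \<beta>. (\<alpha>, \<beta>) \<in> F \<Longrightarrow> eqv (u + \<alpha> + \<gamma>\<^sub>1) (v + \<beta> + \<gamma>\<^sub>1)"
    by blast
  obtain \<gamma>\<^sub>2 where \<gamma>\<^sub>2: "\<gamma>\<^sub>2 \<in> exps K" "\<And>\<alpha> \<beta>. \<alpha> \<in> exps K \<Longrightarrow> \<beta> \<in> exps K \<Longrightarrow>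
      seqv K (v + \<alpha>) (v + \<beta>) \<Longrightarrow> eqv (v + \<alpha> + \<gamma>\<^sub>2) (v + \<beta> + \<gamma>\<^sub>2)"
    using seqv_uniform_witness_same[OF v] by blast
  have "eqv (u + \<alpha> + (\<gamma>\<^sub>1 + \<gamma>\<^sub>2)) (v + \<beta> + (\<gamma>\<^sub>1 + \<gamma>\<^sub>2))"
    if "\<alpha> \<in> exps K" "\<beta> \<in> exps K" "seqv K (u + \<alpha>) (v + \<beta>)" for \<alpha> \<beta>
  proof -
    have "(\<alpha>, \<beta>) \<in> A" using that by (simp add: A_def)
    from F(3)[OF this] obtain \<alpha>\<^sub>0 \<beta>\<^sub>0 \<alpha>' \<beta>' where 0: "(\<alpha>\<^sub>0, \<beta>\<^sub>0) \<in> F" "\<alpha>' \<in> exps K" "\<beta>' \<in> exps K"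
      "\<alpha> = \<alpha>\<^sub>0 + \<alpha>'" "\<beta> = \<beta>\<^sub>0 + \<beta>'"
      by blast
    have A0: "\<alpha>\<^sub>0 \<in> exps K" "\<beta>\<^sub>0 \<in> exps K" "seqv K (u + \<alpha>\<^sub>0) (v + \<beta>\<^sub>0)" using 0(1) F(2) AD by blast+
    have "seqv K (v + \<alpha>') (v + \<beta>')"
      using A0 0 that u v seqv_quotient[of u v \<alpha>\<^sub>0 \<beta>\<^sub>0 \<alpha>' \<beta>'] by simp
    from \<gamma>\<^sub>2(2)[OF 0(2,3) this] have e: "eqv (v + \<alpha>' + \<gamma>\<^sub>2) (v + \<beta>' + \<gamma>\<^sub>2)" .
    have "eqv (v + \<alpha>' + \<gamma>\<^sub>2 + \<gamma>\<^sub>1) (v + \<beta>' + \<gamma>\<^sub>2 + \<gamma>\<^sub>1)"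
      using v 0 \<gamma>\<^sub>1(1) \<gamma>\<^sub>2(1) by (intro eqv_add[OF e]) (auto simp: exps_M[OF K])
    moreover have "eqv (u + \<alpha>\<^sub>0 + \<gamma>\<^sub>1 + \<gamma>\<^sub>2) (v + \<beta>\<^sub>0 + \<gamma>\<^sub>1 + \<gamma>\<^sub>2)"
      using u v A0 0 \<gamma>\<^sub>1(1) \<gamma>\<^sub>2(1) by (intro eqv_add[OF \<gamma>\<^sub>1(2)[OF 0(1)]]) (auto simp: exps_M[OF K])
    ultimately show ?thesis
      unfolding 0 using u v \<gamma>\<^sub>1(1) \<gamma>\<^sub>2(1) A0 0 by (intro eqv_compose) (auto simp: ac_simps)
  qed
  then show ?thesis using \<gamma>\<^sub>1(1) \<gamma>\<^sub>2(1) by (intro bexI[of _ "\<gamma>\<^sub>1 + \<gamma>\<^sub>2"]) auto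
qed

end

section \<open>Comparison far out in a box\<close>

text \<open>
  For \<open>I \<noteq> J\<close> at least one of \<open>u + exps I\<close>, \<open>v + exps J\<close> has no elements deep in every
  direction of \<open>I \<union> J\<close>, so \<open>seqv\<close> need not imply \<open>eqv\<close> here. But once
  \<open>a \<le> b\<close> for one pair with \<open>seqv K a b\<close>, any later pair \<open>a + \<kappa>\<close>, \<open>b + \<eta>\<close> with
  \<open>seqv K (a + \<kappa>) (b + \<eta>)\<close> satisfies \<open>a + \<kappa> \<le> b + \<kappa> \<sim> a + \<eta> \<le> b + \<eta>\<close>, where the mixed
  sums in the middle are deep in all directions.
\<close>
lemma deep_definable:
  assumes I: "I \<subseteq> {1..n}" and J: "J \<subseteq> {1..n}" and u: "u \<in> M" and v: "v \<in> M"
  shows "\<exists>a\<in>exps I. \<exists>b\<in>exps J. \<exists>Q\<in>definable n. \<forall>\<alpha>\<in>exps I. \<forall>\<beta>\<in>exps J.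
    le (u + (a + \<alpha>)) (v + (b + \<beta>)) \<longleftrightarrow> Q (u + (a + \<alpha>)) (v + (b + \<beta>))"
proof -
  define K where "K = I \<union> J"
  have K: "K \<subseteq> {1..n}" using I J by (simp add: K_def)
  have IK: "\<alpha> \<in> exps K" if "\<alpha> \<in> exps I" for \<alpha> using that by (rule exps_mono) (simp add: K_def)
  have JK: "\<beta> \<in> exps K" if "\<beta> \<in> exps J" for \<beta> using that by (rule exps_mono) (simp add: K_def)
  note M = exps_M[OF K]
  obtain \<gamma> where \<gamma>: "\<gamma> \<in> exps K" "\<And>\<alpha> \<beta>. \<alpha> \<in> exps K \<Longrightarrow> \<beta> \<in> exps K \<Longrightarrow>
      seqv K (u + \<alpha>) (v + \<beta>) \<Longrightarrow> eqv (u + \<alpha> + \<gamma>) (v + \<beta> + \<gamma>)"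
    using seqv_uniform_witness[OF K u v] by blast
  \<comment> \<open>The left side can only be moved within \<open>exps I\<close> and the right side
    within \<open>exps J\<close>, so each receives its share of \<open>\<gamma>\<close>.\<close>
  obtain \<gamma>\<^sub>I \<gamma>\<^sub>J where \<gamma>\<^sub>I: "\<gamma>\<^sub>I \<in> exps I" and \<gamma>\<^sub>J: "\<gamma>\<^sub>J \<in> exps J" and \<gamma>_eq: "\<gamma> = \<gamma>\<^sub>I + \<gamma>\<^sub>J"
    using exps_Un \<gamma>(1) unfolding K_def by blast
  show ?thesis
  proof (cases "\<exists>\<alpha>\<in>exps I. \<exists>\<beta>\<in>exps J. seqv K (u + (\<gamma>\<^sub>I + \<alpha>)) (v + (\<gamma>\<^sub>J + \<beta>)) \<and>
      le (u + (\<gamma>\<^sub>I + \<alpha>)) (v + (\<gamma>\<^sub>J + \<beta>))")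
    case True
    then obtain \<alpha>\<^sub>1 \<beta>\<^sub>1 where 1: "\<alpha>\<^sub>1 \<in> exps I" "\<beta>\<^sub>1 \<in> exps J" "seqv K (u + (\<gamma>\<^sub>I + \<alpha>\<^sub>1)) (v + (\<gamma>\<^sub>J + \<beta>\<^sub>1))"
      "le (u + (\<gamma>\<^sub>I + \<alpha>\<^sub>1)) (v + (\<gamma>\<^sub>J + \<beta>\<^sub>1))"
      by blast
    define a where "a = u + (\<gamma>\<^sub>I + \<alpha>\<^sub>1)"
    define b where "b = v + (\<gamma>\<^sub>J + \<beta>\<^sub>1)"
    have ab: "a \<in> M" "b \<in> M" "seqv K a b" "le a b"
      using 1 u v \<gamma>\<^sub>I \<gamma>\<^sub>J by (auto simp: a_def b_def M IK JK)
    obtain Q where Q: "Q \<in> definable n"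
      "\<And>\<alpha> \<beta>. \<alpha> \<in> exps K \<Longrightarrow> \<beta> \<in> exps K \<Longrightarrow> sle K (u + \<alpha>) (v + \<beta>) \<longleftrightarrow> Q (u + \<alpha>) (v + \<beta>)"
      using sle_definable[OF K u v] by blast
    have "le (a + (\<gamma>\<^sub>I + \<alpha>)) (b + (\<gamma>\<^sub>J + \<beta>)) \<longleftrightarrow> sle K (a + (\<gamma>\<^sub>I + \<alpha>)) (b + (\<gamma>\<^sub>J + \<beta>))"
      if \<alpha>: "\<alpha> \<in> exps I" and \<beta>: "\<beta> \<in> exps J" for \<alpha> \<beta>
    proof
      assume sle: "sle K (a + (\<gamma>\<^sub>I + \<alpha>)) (b + (\<gamma>\<^sub>J + \<beta>))"
      define \<kappa> where "\<kappa> = \<gamma>\<^sub>I + \<alpha>"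
      define \<eta> where "\<eta> = \<gamma>\<^sub>J + \<beta>"
      have \<kappa>: "\<kappa> \<in> M" "\<eta> \<in> M" using \<alpha> \<beta> \<gamma>\<^sub>I \<gamma>\<^sub>J by (auto simp: \<kappa>_def \<eta>_def M IK JK)
      show "le (a + (\<gamma>\<^sub>I + \<alpha>)) (b + (\<gamma>\<^sub>J + \<beta>))"
      proof (rule ccontr)
        assume not_le: "\<not> le (a + (\<gamma>\<^sub>I + \<alpha>)) (b + (\<gamma>\<^sub>J + \<beta>))"
        then have "le (b + \<eta>) (a + \<kappa>)"
          using le_linear[of "a + \<kappa>" "b + \<eta>"] ab \<kappa> by (auto simp: \<kappa>_def \<eta>_def)
        then have eq: "seqv K (a + \<kappa>) (b + \<eta>)"
          using sle sle_if_le[OF K] by (simp add: seqv_def \<kappa>_def \<eta>_def)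
        have "seqv K (b + \<kappa>) (b + \<eta>)"
          using seqv_trans[OF K seqv_sym[OF K seqv_add[OF K ab(3), of \<kappa>]] eq] ab \<kappa> by simp
        from seqv_trans[OF K this seqv_sym[OF K seqv_add[OF K ab(3), of \<eta>]]]
        have "seqv K (a + \<eta>) (b + \<kappa>)" using ab \<kappa> by (simp add: seqv_sym[OF K])
        \<comment> \<open>Each mixed sum contains all of \<open>\<gamma>\<close>:
          \<open>a + \<eta>\<close> gets \<open>\<gamma>\<^sub>I\<close> from \<open>a\<close> and
          \<open>\<gamma>\<^sub>J\<close> from \<open>\<eta>\<close>, and
          \<open>b + \<kappa>\<close> gets them from \<open>\<kappa>\<close> and \<open>b\<close>.
          This is why the offsets chosen at the end contain each share twice.\<close>
        then have "seqv K (u + (\<alpha>\<^sub>1 + \<beta>) + \<gamma>) (v + (\<beta>\<^sub>1 + \<alpha>) + \<gamma>)"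
          by (simp add: a_def b_def \<kappa>_def \<eta>_def \<gamma>_eq ac_simps)
        then have "seqv K (u + (\<alpha>\<^sub>1 + \<beta>)) (v + (\<beta>\<^sub>1 + \<alpha>))" using \<gamma>(1) by (rule seqv_cancel[OF K])
        then have "eqv (u + (\<alpha>\<^sub>1 + \<beta>) + \<gamma>) (v + (\<beta>\<^sub>1 + \<alpha>) + \<gamma>)"
          using \<alpha> \<beta> 1 by (intro \<gamma>(2)) (auto simp: IK JK)
        then have "le (b + \<kappa>) (a + \<eta>)"
          by (simp add: eqv_def a_def b_def \<kappa>_def \<eta>_def \<gamma>_eq ac_simps)
        moreover have "le (a + \<kappa>) (b + \<kappa>)" "le (a + \<eta>) (b + \<eta>)"
          using ab \<kappa> le_add by blast+
        ultimately have "le (a + \<kappa>) (b + \<eta>)"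
          using ab \<kappa> le_trans[of "a + \<kappa>" "b + \<kappa>" "a + \<eta>"] le_trans[of "a + \<kappa>" "a + \<eta>" "b + \<eta>"] by simp
        then show False using not_le by (simp add: \<kappa>_def \<eta>_def)
      qed
    qed (rule sle_if_le[OF K])
    moreover have "sle K (a + (\<gamma>\<^sub>I + \<alpha>)) (b + (\<gamma>\<^sub>J + \<beta>)) \<longleftrightarrow> Q (a + (\<gamma>\<^sub>I + \<alpha>)) (b + (\<gamma>\<^sub>J + \<beta>))"
      if "\<alpha> \<in> exps I" "\<beta> \<in> exps J" for \<alpha> \<beta>
      using Q(2)[of "\<gamma>\<^sub>I + \<alpha>\<^sub>1 + (\<gamma>\<^sub>I + \<alpha>)" "\<gamma>\<^sub>J + \<beta>\<^sub>1 + (\<gamma>\<^sub>J + \<beta>)"] that 1 \<gamma>\<^sub>I \<gamma>\<^sub>J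
      by (simp add: IK JK a_def b_def add.assoc)
    ultimately show ?thesis
      using Q(1) \<gamma>\<^sub>I \<gamma>\<^sub>J 1
      by (intro bexI[of _ "\<gamma>\<^sub>I + \<alpha>\<^sub>1 + \<gamma>\<^sub>I"] bexI[of _ "\<gamma>\<^sub>J + \<beta>\<^sub>1 + \<gamma>\<^sub>J"] bexI[of _ Q])
        (auto simp: a_def b_def add.assoc)
  next
    \<comment> \<open>No equivalent pair this deep satisfies \<open>le\<close>, so \<open>le\<close>
      is the strict part of \<open>sle K\<close>, that is, the negation of the reversed
      \<open>sle K\<close>.\<close>
    case False
    obtain Q where Q: "Q \<in> definable n"
      "\<And>\<alpha> \<beta>. \<alpha> \<in> exps K \<Longrightarrow> \<beta> \<in> exps K \<Longrightarrow> sle K (v + \<alpha>) (u + \<beta>) \<longleftrightarrow> Q (v + \<alpha>) (u + \<beta>)"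
      using sle_definable[OF K v u] by blast
    have "le (u + (\<gamma>\<^sub>I + \<alpha>)) (v + (\<gamma>\<^sub>J + \<beta>)) \<longleftrightarrow> \<not> Q (v + (\<gamma>\<^sub>J + \<beta>)) (u + (\<gamma>\<^sub>I + \<alpha>))"
      if \<alpha>: "\<alpha> \<in> exps I" and \<beta>: "\<beta> \<in> exps J" for \<alpha> \<beta>
    proof -
      have "sle K (v + (\<gamma>\<^sub>J + \<beta>)) (u + (\<gamma>\<^sub>I + \<alpha>)) \<longleftrightarrow> Q (v + (\<gamma>\<^sub>J + \<beta>)) (u + (\<gamma>\<^sub>I + \<alpha>))"
        using Q(2)[of "\<gamma>\<^sub>J + \<beta>" "\<gamma>\<^sub>I + \<alpha>"] \<alpha> \<beta> \<gamma>\<^sub>I \<gamma>\<^sub>J by (simp add: IK JK)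
      moreover have "le (u + (\<gamma>\<^sub>I + \<alpha>)) (v + (\<gamma>\<^sub>J + \<beta>)) \<or> le (v + (\<gamma>\<^sub>J + \<beta>)) (u + (\<gamma>\<^sub>I + \<alpha>))"
        using u v \<alpha> \<beta> \<gamma>\<^sub>I \<gamma>\<^sub>J by (intro le_linear) (auto simp: M IK JK)
      ultimately show ?thesis
        using False \<alpha> \<beta> sle_if_le[OF K] unfolding seqv_def by blast
    qed
    then show ?thesis
      using \<gamma>\<^sub>I \<gamma>\<^sub>J boolean_combinations.neg[OF definable_swap[OF Q(1)]]
      by (intro bexI[of _ \<gamma>\<^sub>I] bexI[of _ \<gamma>\<^sub>J] bexI[of _ "\<lambda>\<alpha> \<beta>. \<not> Q \<beta> \<alpha>"]) auto
  qed
qed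

section \<open>Gluing over slices of a box\<close>

text \<open>Agreement is required only where \<open>X\<close> holds; \<open>X\<close> may be any
  predicate and need not be definable.\<close>

definition definable_on :: "((nat \<Rightarrow>\<^sub>0 nat) \<Rightarrow> (nat \<Rightarrow>\<^sub>0 nat) \<Rightarrow> bool) \<Rightarrow> bool" where
  "definable_on X \<longleftrightarrow> (\<exists>Q\<in>definable n. \<forall>\<alpha> \<beta>. X \<alpha> \<beta> \<longrightarrow> (le \<alpha> \<beta> \<longleftrightarrow> Q \<alpha> \<beta>))"

lemma definable_on_mono: "definable_on X \<Longrightarrow> (\<And>\<alpha> \<beta>. Y \<alpha> \<beta> \<Longrightarrow> X \<alpha> \<beta>) \<Longrightarrow> definable_on Y"
  unfolding definable_on_def by blast

lemma definable_on_split: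
  assumes "R \<in> definable n" "definable_on (\<lambda>\<alpha> \<beta>. X \<alpha> \<beta> \<and> R \<alpha> \<beta>)" "definable_on (\<lambda>\<alpha> \<beta>. X \<alpha> \<beta> \<and> \<not> R \<alpha> \<beta>)"
  shows "definable_on X"
proof -
  obtain Q where Q: "Q \<in> definable n" "\<And>\<alpha> \<beta>. X \<alpha> \<beta> \<Longrightarrow> R \<alpha> \<beta> \<Longrightarrow> le \<alpha> \<beta> \<longleftrightarrow> Q \<alpha> \<beta>"
    using assms(2) unfolding definable_on_def by blast
  obtain Q' where Q': "Q' \<in> definable n" "\<And>\<alpha> \<beta>. X \<alpha> \<beta> \<Longrightarrow> \<not> R \<alpha> \<beta> \<Longrightarrow> le \<alpha> \<beta> \<longleftrightarrow> Q' \<alpha> \<beta>"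
    using assms(3) unfolding definable_on_def by blast
  have "(\<lambda>\<alpha> \<beta>. (R \<alpha> \<beta> \<and> Q \<alpha> \<beta>) \<or> (\<not> R \<alpha> \<beta> \<and> Q' \<alpha> \<beta>)) \<in> definable n"
    by (intro definable_intros assms(1) Q(1) Q'(1))
  then show ?thesis unfolding definable_on_def by (rule bexI[rotated]) (use Q(2) Q'(2) in auto)
qed

lemma definable_on_finite_split:
  assumes "finite T" "T \<subseteq> definable n"
    and "\<And>R. R \<in> T \<Longrightarrow> definable_on (\<lambda>\<alpha> \<beta>. X \<alpha> \<beta> \<and> R \<alpha> \<beta>)"
    and "definable_on (\<lambda>\<alpha> \<beta>. X \<alpha> \<beta> \<and> (\<forall>R\<in>T. \<not> R \<alpha> \<beta>))"
  shows "definable_on X"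
  using assms
proof (induction T arbitrary: X rule: finite_induct)
  case empty
  then show ?case by simp
next
  case (insert R T)
  have "definable_on (\<lambda>\<alpha> \<beta>. X \<alpha> \<beta> \<and> \<not> R \<alpha> \<beta>)"
  proof (rule insert.IH)
    show "definable_on (\<lambda>\<alpha> \<beta>. (X \<alpha> \<beta> \<and> \<not> R \<alpha> \<beta>) \<and> R' \<alpha> \<beta>)" if "R' \<in> T" for R'
      using insert.prems(2)[of R'] that by (auto elim: definable_on_mono)
    show "definable_on (\<lambda>\<alpha> \<beta>. (X \<alpha> \<beta> \<and> \<not> R \<alpha> \<beta>) \<and> (\<forall>R\<in>T. \<not> R \<alpha> \<beta>))"
      using insert.prems(3) by (auto elim: definable_on_mono)
  qed (use insert.prems(1) in simp)
  then show ?case using insert.prems(1,2) by (intro definable_on_split[of R X]) auto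
qed

text \<open>Induction on the number of free coordinates. Above the offsets \<open>a\<close> and
  \<open>b\<close>, \<open>deep_definable\<close> applies; elsewhere some coordinate takes one of
  finitely many values, and fixing it leaves a box with fewer free coordinates and a shifted base
  point.\<close>

lemma box_definable:
  assumes "I \<subseteq> {1..n}" "J \<subseteq> {1..n}" "u \<in> M" "v \<in> M"
  shows "definable_on (\<lambda>\<alpha>' \<beta>'. \<exists>\<alpha>\<in>exps I. \<exists>\<beta>\<in>exps J. \<alpha>' = u + \<alpha> \<and> \<beta>' = v + \<beta>)"
  using assms
proof (induction "card I + card J" arbitrary: I J u v rule: less_induct)
  case less
  note I = less.prems(1) and J = less.prems(2) and u = less.prems(3) and v = less.prems(4)
  have fin: "finite I" "finite J" using I J finite_subset by blast+
  obtain a b Q where ab: "a \<in> exps I" "b \<in> exps J" and Q: "Q \<in> definable n"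
    "\<And>\<alpha> \<beta>. \<alpha> \<in> exps I \<Longrightarrow> \<beta> \<in> exps J \<Longrightarrow>
      le (u + (a + \<alpha>)) (v + (b + \<beta>)) \<longleftrightarrow> Q (u + (a + \<alpha>)) (v + (b + \<beta>))"
    using deep_definable[OF I J u v] by blast
  let ?X = "\<lambda>\<alpha>' \<beta>'. \<exists>\<alpha>\<in>exps I. \<exists>\<beta>\<in>exps J. \<alpha>' = u + \<alpha> \<and> \<beta>' = v + \<beta>"
  define L :: "nat \<times> nat \<Rightarrow> (nat \<Rightarrow>\<^sub>0 nat) \<Rightarrow> (nat \<Rightarrow>\<^sub>0 nat) \<Rightarrow> bool" where
    "L = (\<lambda>(i, c) \<alpha> \<beta>. lookup \<alpha> i = lookup u i + c)"
  define R :: "nat \<times> nat \<Rightarrow> (nat \<Rightarrow>\<^sub>0 nat) \<Rightarrow> (nat \<Rightarrow>\<^sub>0 nat) \<Rightarrow> bool" where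
    "R = (\<lambda>(j, c) \<alpha> \<beta>. lookup \<beta> j = lookup v j + c)"
  \<comment> \<open>The conditions that pin one coordinate, measured from the base point, to a value
    below the deep threshold.\<close>
  define T where "T = L ` (SIGMA i:I. {..<lookup a i}) \<union> R ` (SIGMA j:J. {..<lookup b j})"
  have slice: "\<exists>\<alpha>'\<in>exps (A - {i}). \<alpha> = Poly_Mapping.single i (lookup \<alpha> i) + \<alpha>'"
    if "\<alpha> \<in> exps A" for A \<alpha> and i :: nat
  proof
    show "\<alpha> = Poly_Mapping.single i (lookup \<alpha> i) + (\<alpha> - Poly_Mapping.single i (lookup \<alpha> i))"
      by (rule poly_mapping_eqI) (simp add: lookup_add lookup_minus lookup_single when_def)
    show "\<alpha> - Poly_Mapping.single i (lookup \<alpha> i) \<in> exps (A - {i})"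
      using that by (auto simp: exps_iff lookup_minus lookup_single when_def)
  qed
  have single: "Poly_Mapping.single i c \<in> M" if "i \<in> {1..n}" for i c
    using that unfolding M_def exps_single by blast
  show ?case
  proof (rule definable_on_finite_split)
    show "finite T" using fin by (simp add: T_def)
    show "T \<subseteq> definable n"
      using I J definable_eq_left definable_eq_right by (auto simp: T_def L_def R_def simp del: atLeastAtMost_iff)
    fix S assume "S \<in> T"
    then consider i c where "i \<in> I" "S = L (i, c)" | j c where "j \<in> J" "S = R (j, c)"
      by (auto simp: T_def)
    then show "definable_on (\<lambda>\<alpha> \<beta>. ?X \<alpha> \<beta> \<and> S \<alpha> \<beta>)"
    proof cases
      case (1 i c)
      have "card (I - {i}) + card J < card I + card J" using card_Diff1_less[of I i] 1(1) fin by simp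
      moreover have "u + Poly_Mapping.single i c \<in> M" using 1(1) I u single by auto
      ultimately have "definable_on (\<lambda>\<alpha>' \<beta>'. \<exists>\<alpha>\<in>exps (I - {i}). \<exists>\<beta>\<in>exps J.
          \<alpha>' = u + Poly_Mapping.single i c + \<alpha> \<and> \<beta>' = v + \<beta>)"
        using I J v by (intro less.hyps) auto
      then show ?thesis
      proof (rule definable_on_mono)
        fix \<alpha>' \<beta>' assume "?X \<alpha>' \<beta>' \<and> S \<alpha>' \<beta>'"
        then obtain \<alpha> \<beta> where *: "\<alpha> \<in> exps I" "\<beta> \<in> exps J" "\<alpha>' = u + \<alpha>" "\<beta>' = v + \<beta>" "lookup \<alpha> i = c"
          unfolding 1(2) L_def by (auto simp: lookup_add)
        then show "\<exists>\<alpha>\<in>exps (I - {i}). \<exists>\<beta>\<in>exps J. \<alpha>' = u + Poly_Mapping.single i c + \<alpha> \<and> \<beta>' = v + \<beta>"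
          using slice[OF *(1), of i] by (metis add.assoc)
      qed
    next
      case (2 j c)
      have "card I + card (J - {j}) < card I + card J" using card_Diff1_less[of J j] 2(1) fin by simp
      moreover have "v + Poly_Mapping.single j c \<in> M" using 2(1) J v single by auto
      ultimately have "definable_on (\<lambda>\<alpha>' \<beta>'. \<exists>\<alpha>\<in>exps I. \<exists>\<beta>\<in>exps (J - {j}).
          \<alpha>' = u + \<alpha> \<and> \<beta>' = v + Poly_Mapping.single j c + \<beta>)"
        using I J u by (intro less.hyps) auto
      then show ?thesis
      proof (rule definable_on_mono)
        fix \<alpha>' \<beta>' assume "?X \<alpha>' \<beta>' \<and> S \<alpha>' \<beta>'"
        then obtain \<alpha> \<beta> where *: "\<alpha> \<in> exps I" "\<beta> \<in> exps J" "\<alpha>' = u + \<alpha>" "\<beta>' = v + \<beta>" "lookup \<beta> j = c"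
          unfolding 2(2) R_def by (auto simp: lookup_add)
        then show "\<exists>\<alpha>\<in>exps I. \<exists>\<beta>\<in>exps (J - {j}). \<alpha>' = u + \<alpha> \<and> \<beta>' = v + Poly_Mapping.single j c + \<beta>"
          using slice[OF *(2), of j] by (metis add.assoc)
      qed
    qed
  next
    have "le \<alpha>' \<beta>' \<longleftrightarrow> Q \<alpha>' \<beta>'" if X: "?X \<alpha>' \<beta>'" and T: "\<forall>S\<in>T. \<not> S \<alpha>' \<beta>'" for \<alpha>' \<beta>'
    proof -
      obtain \<alpha> \<beta> where *: "\<alpha> \<in> exps I" "\<beta> \<in> exps J" "\<alpha>' = u + \<alpha>" "\<beta>' = v + \<beta>" using X by blast
      \<comment> \<open>A coordinate falling short would itself name a slice in
        \<open>T\<close>.\<close>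
      have "lookup a i \<le> lookup \<alpha> i" if "i \<in> I" for i
      proof (rule ccontr)
        assume "\<not> lookup a i \<le> lookup \<alpha> i"
        then have "L (i, lookup \<alpha> i) \<in> T" using that by (auto simp: T_def)
        then show False using T by (auto simp: L_def * lookup_add)
      qed
      then have \<alpha>: "a + (\<alpha> - a) = \<alpha>" by (rule exps_add_minus[OF ab(1)])
      have "lookup b j \<le> lookup \<beta> j" if "j \<in> J" for j
      proof (rule ccontr)
        assume "\<not> lookup b j \<le> lookup \<beta> j"
        then have "R (j, lookup \<beta> j) \<in> T" using that by (auto simp: T_def)
        then show False using T by (auto simp: R_def * lookup_add)
      qed
      then have \<beta>: "b + (\<beta> - b) = \<beta>" by (rule exps_add_minus[OF ab(2)])
      show ?thesis
        using Q(2)[OF exps_minus[OF *(1)] exps_minus[OF *(2)], of a b] by (simp add: \<alpha> \<beta> *)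
    qed
    then show "definable_on (\<lambda>\<alpha> \<beta>. ?X \<alpha> \<beta> \<and> (\<forall>S\<in>T. \<not> S \<alpha> \<beta>))"
      unfolding definable_on_def by (intro bexI[OF _ Q(1)] allI impI) (elim conjE, blast)
  qed
qed

end

theorem theoremC:
  fixes n :: nat and le :: "(nat \<Rightarrow>\<^sub>0 nat) \<Rightarrow> (nat \<Rightarrow>\<^sub>0 nat) \<Rightarrow> bool"
  assumes "comm_monoid_preorder (Mon n) le"
  shows "\<exists>Q \<in> boolean_combinations (basic_inequalities n).
    \<forall>\<alpha> \<in> carrier (Mon n). \<forall>\<beta> \<in> carrier (Mon n). le \<alpha> \<beta> \<longleftrightarrow> Q \<alpha> \<beta>"
proof -
  interpret monomial_preorder n le by (rule monomial_preorder.intro) fact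
  \<comment> \<open>The whole monoid is the box with both base points 0 and all coordinates
    free.\<close>
  have "definable_on (\<lambda>\<alpha>' \<beta>'. \<exists>\<alpha>\<in>M. \<exists>\<beta>\<in>M. \<alpha>' = 0 + \<alpha> \<and> \<beta>' = 0 + \<beta>)"
    unfolding M_def by (rule box_definable) (simp_all add: M_def)
  then show ?thesis unfolding definable_on_def carrier_Mon by auto
qed

end
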